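(* Let $n=7$ and let $\boldsymbol v^0$ be the septuple-periodic field of the context at either of the phase vectors $$\boldsymbol\xi^{*}=\left(-\tfrac{\pi}{4},\tfrac{\pi}{4},\tfrac{\pi}{4},\tfrac{\pi}{4},\tfrac{\pi}{4},\tfrac{\pi}{4},\tfrac{\pi}{4}\right)\quad\text{or}\quad\boldsymbol\xi^{**}=\left(0,\tfrac{\pi}{2},\pi,\pi,\pi,\pi,\pi\right),$$ neither of which satisfies the reduction condition. Then $\boldsymbol v^0\not\equiv\boldsymbol0$ and $\nabla\cdot\boldsymbol v^0=0$; with $\boldsymbol g^0=(\boldsymbol v^0\cdot\nabla)\boldsymbol v^0$, $\nabla\cdot\boldsymbol g^0=0$ identically, so $\boldsymbol g^0$ is purely transverse; $\boldsymbol g^0$ is not a gradient; and consequently the pressure carries no spatial dependence (every spatially periodic solution of $\Delta p=-\rho\,\nabla\cdot\boldsymbol g^0$ is constant in $\boldsymbol x$). With the body-force amplitude $\boldsymbol f^0=\boldsymbol g^0=\nabla\cdot(\boldsymbol v^0\otimes\boldsymbol v^0)$, which has zero mean over a periodic cell, the velocity $\boldsymbol v(\boldsymbol x,t)=\boldsymbol v^0(\boldsymbol x)e^{-7\alpha^2\kappa t}$ together with the pressure $p(\boldsymbol x,t)=p(t)$, $\nabla p=\boldsymbol0$, is an exact solution of the incompressible Navier--Stokes equations on $\mathbb R^7$, $t\ge0$, under the body force $\boldsymbol f(\boldsymbol x,t)=\boldsymbol f^0(\boldsymbol x)e^{-14\alpha^2\kappa t}$.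
   Context: Fix $\alpha>0$, $v_r>0$, density $\rho>0$, viscosity $\kappa>0$. The first component of the field is $$\frac{v_1^0}{v_r}=\sin(\alpha x_1+\xi_1)\cos(\alpha x_2+\xi_2)\sin(\alpha x_3+\xi_3)\cos(\alpha x_4+\xi_4)\sin(\alpha x_5+\xi_5)\cos(\alpha x_6+\xi_6)\sin(\alpha x_7+\xi_7)$$ $$-\sin(\alpha x_1+\xi_2)\sin(\alpha x_2+\xi_3)\cos(\alpha x_3+\xi_4)\sin(\alpha x_4+\xi_5)\cos(\alpha x_5+\xi_6)\sin(\alpha x_6+\xi_7)\cos(\alpha x_7+\xi_1),$$ and $v_i^0$ is obtained from $v_1^0$ by the cyclic coordinate permutation $x_j\mapsto x_{i+j-1}$ (indices modulo 7, in $\{1,\dots,7\}$) with the same $\boldsymbol\xi$. Reduction condition: for each $i$ the $x_i$-independent part of $g_i^0$ (the sum of its Fourier modes with $k_i=0$) vanishes identically. "Purely transverse" means divergence-free, i.e. the longitudinal part $\nabla\phi$ ($\Delta\phi=\nabla\cdot\boldsymbol g^0$) of its periodic Helmholtz decomposition vanishes. Here $(\nabla\cdot(\boldsymbol v\otimes\boldsymbol v))_i=\sum_j\partial_j(v_iv_j)$. The incompressible Navier--Stokes equations are $\partial_tv_i+\sum_jv_j\partial_jv_i=\kappa\Delta v_i-\rho^{-1}\partial_ip+f_i$ for all $i$, and $\nabla\cdot\boldsymbol v=0$. *)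

theory Defs
  imports "HOL-Analysis.Analysis"
begin

section \<open>Classical vector calculus on \<open>real ^ 'n\<close>\<close>

definition partial :: "'n::finite \<Rightarrow> (real^'n \<Rightarrow> real) \<Rightarrow> real^'n \<Rightarrow> real"
  where "partial j f x = deriv (\<lambda>s. f (x + s *\<^sub>R axis j 1)) 0"

text \<open>\<^const>\<open>partial\<close> has an arbitrary value where the derivative does not exist, so
  statements about derivatives are paired with the following regularity predicates.\<close>

definition C1 :: "(real^'n::finite \<Rightarrow> real) \<Rightarrow> bool"
  where "C1 f \<longleftrightarrow> f differentiable_on UNIV \<and> (\<forall>j. continuous_on UNIV (partial j f))"

definition C2 :: "(real^'n::finite \<Rightarrow> real) \<Rightarrow> bool"
  where "C2 f \<longleftrightarrow> C1 f \<and> (\<forall>j. C1 (partial j f))"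

definition gradient :: "(real^'n::finite \<Rightarrow> real) \<Rightarrow> real^'n \<Rightarrow> real^'n"
  where "gradient f x = (\<chi> j. partial j f x)"

definition laplacian :: "(real^'n::finite \<Rightarrow> real) \<Rightarrow> real^'n \<Rightarrow> real"
  where "laplacian f x = (\<Sum>j\<in>UNIV. partial j (partial j f) x)"

definition divergence :: "(real^'n::finite \<Rightarrow> real^'n) \<Rightarrow> real^'n \<Rightarrow> real"
  where "divergence u x = (\<Sum>j\<in>UNIV. partial j (\<lambda>y. u y $ j) x)"

definition advection :: "(real^'n::finite \<Rightarrow> real^'n) \<Rightarrow> (real^'n \<Rightarrow> real^'n) \<Rightarrow> real^'n \<Rightarrow> real^'n"
  where "advection u w x = (\<chi> i. \<Sum>j\<in>UNIV. u x $ j * partial j (\<lambda>y. w y $ i) x)"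

definition outer_product ::
    "(real^'n::finite \<Rightarrow> real^'n) \<Rightarrow> (real^'n \<Rightarrow> real^'n) \<Rightarrow> real^'n \<Rightarrow> real^'n^'n"
  where "outer_product u w x = (\<chi> i j. u x $ i * w x $ j)"

definition tensor_divergence :: "(real^'n::finite \<Rightarrow> real^'n^'n) \<Rightarrow> real^'n \<Rightarrow> real^'n"
  where "tensor_divergence T x = (\<chi> i. \<Sum>j\<in>UNIV. partial j (\<lambda>y. T y $ i $ j) x)"

definition divergence_free :: "(real^'n::finite \<Rightarrow> real^'n) \<Rightarrow> bool"
  where "divergence_free u \<longleftrightarrow> (\<forall>i. C1 (\<lambda>x. u x $ i)) \<and> (\<forall>x. divergence u x = 0)"

definition is_gradient :: "(real^'n::finite \<Rightarrow> real^'n) \<Rightarrow> bool"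
  where "is_gradient u \<longleftrightarrow> (\<exists>\<phi>. \<phi> differentiable_on UNIV \<and> (\<forall>x. u x = gradient \<phi> x))"


section \<open>Periodic fields\<close>

definition periodic :: "real \<Rightarrow> (real^'n::finite \<Rightarrow> 'b) \<Rightarrow> bool"
  where "periodic L f \<longleftrightarrow> (\<forall>x j. f (x + L *\<^sub>R axis j 1) = f x)"

text \<open>The longitudinal part of the periodic Helmholtz decomposition of \<open>u\<close> is
  \<open>\<nabla>\<phi>\<close>, where \<open>\<phi>\<close> is a periodic solution of \<open>\<Delta>\<phi> = \<nabla> \<cdot> u\<close>.  It is given here as a relation;
  the equivalence in \<open>purely_transverse\<close> says that the longitudinal part exists, is unique,
  and is the zero field.\<close>

definition is_longitudinal_part ::
    "real \<Rightarrow> (real^'n::finite \<Rightarrow> real^'n) \<Rightarrow> (real^'n \<Rightarrow> real^'n) \<Rightarrow> bool"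
  where "is_longitudinal_part L u w \<longleftrightarrow>
    (\<exists>\<phi>. C2 \<phi> \<and> periodic L \<phi> \<and> (\<forall>x. laplacian \<phi> x = divergence u x) \<and> w = gradient \<phi>)"

definition purely_transverse :: "real \<Rightarrow> (real^'n::finite \<Rightarrow> real^'n) \<Rightarrow> bool"
  where "purely_transverse L u \<longleftrightarrow>
    divergence_free u \<and> (\<forall>w. is_longitudinal_part L u w \<longleftrightarrow> w = (\<lambda>x. 0))"

definition wave_phase :: "real \<Rightarrow> int^'n::finite \<Rightarrow> real^'n \<Rightarrow> real"
  where "wave_phase L k x = (2 * pi / L) * (\<Sum>j\<in>UNIV. of_int (k $ j) * x $ j)"

definition fourier_coeff :: "real \<Rightarrow> (real^'n::finite \<Rightarrow> real) \<Rightarrow> int^'n \<Rightarrow> complex"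
  where "fourier_coeff L f k =
    integral (cbox 0 (\<chi> j. L)) (\<lambda>x. of_real (f x) * cis (- wave_phase L k x)) / of_real (L ^ CARD('n))"

definition independent_part :: "real \<Rightarrow> 'n::finite \<Rightarrow> (real^'n \<Rightarrow> real) \<Rightarrow> real^'n \<Rightarrow> complex"
  where "independent_part L i f x =
    (\<Sum>\<^sub>\<infinity>k\<in>{k. k $ i = 0}. fourier_coeff L f k * cis (wave_phase L k x))"

definition reduction_condition :: "real \<Rightarrow> (real^'n::finite \<Rightarrow> real^'n) \<Rightarrow> bool"
  where "reduction_condition L g \<longleftrightarrow> (\<forall>i x. independent_part L i (\<lambda>y. g y $ i) x = 0)"


section \<open>The incompressible Navier--Stokes equations\<close>

text \<open>Classical solutions on \<open>\<real>\<^sup>n \<times> [0, \<infinity>)\<close>; the time derivative at \<open>t = 0\<close> is one-sided.\<close>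

definition navier_stokes_solution ::
    "real \<Rightarrow> real \<Rightarrow> (real \<Rightarrow> real^'n::finite \<Rightarrow> real^'n) \<Rightarrow> (real \<Rightarrow> real^'n \<Rightarrow> real^'n) \<Rightarrow>
     (real \<Rightarrow> real^'n \<Rightarrow> real) \<Rightarrow> bool"
  where "navier_stokes_solution \<rho> \<kappa> f v p \<longleftrightarrow>
    (\<forall>t\<ge>0. \<forall>i. C2 (\<lambda>x. v t x $ i)) \<and>
    (\<forall>t\<ge>0. C1 (p t)) \<and>
    (\<forall>t\<ge>0. \<forall>x i. (\<lambda>s. v s x $ i) differentiable (at t within {0..})) \<and>
    (\<forall>t\<ge>0. \<forall>x i.
       vector_derivative (\<lambda>s. v s x $ i) (at t within {0..})
         + (\<Sum>j\<in>UNIV. v t x $ j * partial j (\<lambda>y. v t y $ i) x)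
       = \<kappa> * laplacian (\<lambda>y. v t y $ i) x - inverse \<rho> * partial i (p t) x + f t x $ i) \<and>
    (\<forall>t\<ge>0. \<forall>x. divergence (v t) x = 0)"


section \<open>The septuple-periodic field\<close>

text \<open>Indices range over the type \<open>7\<close> of integers modulo 7, where the index \<open>7\<close> equals \<open>0\<close>;
  this makes \<open>i + j - 1\<close> in \<open>base_velocity\<close> the cyclic index shift.\<close>

definition first_component :: "real \<Rightarrow> real \<Rightarrow> real^7 \<Rightarrow> real^7 \<Rightarrow> real"
  where "first_component \<alpha> v\<^sub>r \<xi> x = v\<^sub>r *
    (sin (\<alpha> * x $ 1 + \<xi> $ 1) * cos (\<alpha> * x $ 2 + \<xi> $ 2) * sin (\<alpha> * x $ 3 + \<xi> $ 3) *
     cos (\<alpha> * x $ 4 + \<xi> $ 4) * sin (\<alpha> * x $ 5 + \<xi> $ 5) * cos (\<alpha> * x $ 6 + \<xi> $ 6) *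
     sin (\<alpha> * x $ 7 + \<xi> $ 7)
   - sin (\<alpha> * x $ 1 + \<xi> $ 2) * sin (\<alpha> * x $ 2 + \<xi> $ 3) * cos (\<alpha> * x $ 3 + \<xi> $ 4) *
     sin (\<alpha> * x $ 4 + \<xi> $ 5) * cos (\<alpha> * x $ 5 + \<xi> $ 6) * sin (\<alpha> * x $ 6 + \<xi> $ 7) *
     cos (\<alpha> * x $ 7 + \<xi> $ 1))"

definition base_velocity :: "real \<Rightarrow> real \<Rightarrow> real^7 \<Rightarrow> real^7 \<Rightarrow> real^7"
  where "base_velocity \<alpha> v\<^sub>r \<xi> x = (\<chi> i. first_component \<alpha> v\<^sub>r \<xi> (\<chi> j. x $ (i + j - 1)))"

end

theory Submission
  imports Defs
begin

text \<open>Both velocity fields are superpositions of plane waves all of whose wave numbers are \<open>\<plusminus>1\<close> in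
every coordinate. For a function \<open>f\<close> of this kind differentiation is translation by a quarter
period, \<open>\<partial>\<^sub>j f(x) = \<alpha> f(x + (L/4) e\<^sub>j)\<close>, and two quarter periods change its sign. Hence
\<open>\<Delta>v = - 7 \<alpha>\<^sup>2 v\<close>, the heat flow is the decay \<open>e\<^bsup>-7\<alpha>\<^sup>2\<kappa>t\<^esup>\<close>, and the force \<open>(v \<cdot> \<nabla>)v\<close>,
decaying twice as fast, balances the convection with no pressure (\<open>navier_stokes_decay\<close>).

The identity \<open>\<nabla> \<cdot> (v \<cdot> \<nabla>)v = \<Sum>\<^sub>i\<^sub>j \<partial>\<^sub>jv\<^sub>i \<partial>\<^sub>iv\<^sub>j = 0\<close> is where the two phase vectors matter. Up
to the amplitude, the field for \<open>\<xi>\<^sup>*\<^sup>*\<close> is a canonical wave, and the field for \<open>\<xi>\<^sup>*\<close> becomes the same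
wave after a translation, a change of sign and the reflection \<open>i \<mapsto> -i\<close> of the cyclic index. The
canonical wave is \<open>v\<^sub>i = A\<^sub>i + B\<^sub>i\<close>, in which \<open>A\<^sub>i\<close> and \<open>B\<^sub>i\<close> are products of one sine or
cosine of each of the seven phases (\<open>base_velocity_waves\<close>). Every \<open>\<partial>\<^sub>jv\<^sub>i\<close> is then a sum of two
signed monomials, and the products \<open>\<partial>\<^sub>jv\<^sub>i \<partial>\<^sub>iv\<^sub>j\<close> cancel against each other by seven
cyclic identities between monomials (\<open>wave_pairings\<close>, \<open>wave_gradient_square\<close>).

The statements on transversality and pressure rest on the periodic Liouville theorem: a periodic
harmonic function is constant (\<open>periodic_harmonic_constant\<close>). It also shows that \<open>g = (v \<cdot> \<nabla>)v\<close>
is not a gradient: a potential of a periodic field is a periodic function plus a linear one, so a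
solenoidal periodic gradient is constant, and \<open>g\<close> has mean zero. There remains \<open>g \<noteq> 0\<close>, which
follows from the failure of the reduction condition. The wave numbers of \<open>g\<close> lie in \<open>{-2, 0, 2}\<close>,
so averaging \<open>g\<^sub>i\<close> over \<open>x\<close> and \<open>x + (L/4) e\<^sub>i\<close> deletes exactly the modes with \<open>k\<^sub>i \<noteq> 0\<close>
(\<open>independent_part_trig_poly\<close>), and this average is nonzero at an explicit point.\<close>

section \<open>Rules for partial derivatives\<close>

lemma real_derivative_axis_frechet:
  fixes f :: "real^'n::finite \<Rightarrow> real"
  assumes "(f has_derivative D) (at (x + t *\<^sub>R axis j 1))"
  shows "((\<lambda>s. f (x + s *\<^sub>R axis j 1)) has_real_derivative D (axis j 1)) (at t)"
proof -
  have "((\<lambda>s. x + s *\<^sub>R axis j (1::real)) has_derivative (\<lambda>s. s *\<^sub>R axis j 1)) (at t)"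
    by (auto intro!: derivative_eq_intros)
  from has_derivative_compose[OF this assms]
  show ?thesis
    unfolding has_field_derivative_def linear_cmul[OF has_derivative_linear[OF assms]]
    by (simp add: mult_commute_abs)
qed

lemma partial_eqI:
  assumes "((\<lambda>s. f (x + s *\<^sub>R axis j 1)) has_real_derivative D) (at 0)"
  shows "partial j f x = D"
  using assms unfolding partial_def by (rule DERIV_imp_deriv)

lemma partial_frechet:
  assumes "(f has_derivative D) (at x)"
  shows "partial j f x = D (axis j 1)"
  using real_derivative_axis_frechet[of f D x 0 j] assms by (intro partial_eqI) simp

lemma real_derivative_along_axis:
  assumes "f differentiable_on UNIV"
  shows "((\<lambda>s. f (x + s *\<^sub>R axis j 1)) has_real_derivative partial j f (x + t *\<^sub>R axis j 1)) (at t within S)"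
proof -
  obtain D where D: "(f has_derivative D) (at (x + t *\<^sub>R axis j 1))"
    using assms by (auto simp: differentiable_on_def differentiable_def)
  show ?thesis
    using has_field_derivative_at_within[OF real_derivative_axis_frechet[OF D]]
    by (simp add: partial_frechet[OF D])
qed

lemma real_derivative_partial:
  assumes "f differentiable_on UNIV"
  shows "((\<lambda>s. f (x + s *\<^sub>R axis j 1)) has_real_derivative partial j f x) (at 0)"
  using real_derivative_along_axis[OF assms, of x j 0] by simp

lemma partial_const [simp]: "partial j (\<lambda>x. c) = (\<lambda>x. 0)"
  by (auto simp: partial_def fun_eq_iff)

lemma partial_add:
  assumes "f differentiable_on UNIV" "g differentiable_on UNIV"
  shows "partial j (\<lambda>x. f x + g x) = (\<lambda>x. partial j f x + partial j g x)"
  by (rule ext, rule partial_eqI)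
     (intro DERIV_add real_derivative_partial assms)

lemma partial_cmult:
  assumes "f differentiable_on UNIV"
  shows "partial j (\<lambda>x. c * f x) = (\<lambda>x. c * partial j f x)"
  by (rule ext, rule partial_eqI) (intro DERIV_cmult real_derivative_partial assms)

lemma partial_mult:
  assumes "f differentiable_on UNIV" "g differentiable_on UNIV"
  shows "partial j (\<lambda>x. f x * g x) = (\<lambda>x. partial j f x * g x + f x * partial j g x)"
proof (rule ext, rule partial_eqI)
  fix x
  show "((\<lambda>s. f (x + s *\<^sub>R axis j 1) * g (x + s *\<^sub>R axis j 1)) has_real_derivative
         partial j f x * g x + f x * partial j g x) (at 0)"
    using DERIV_mult[OF real_derivative_partial[OF assms(1), of x j] real_derivative_partial[OF assms(2), of x j]]
    by (simp add: algebra_simps)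
qed

lemma partial_sum:
  assumes "finite A" "\<And>i. i \<in> A \<Longrightarrow> f i differentiable_on UNIV"
  shows "partial j (\<lambda>x. \<Sum>i\<in>A. f i x) = (\<lambda>x. \<Sum>i\<in>A. partial j (f i) x)"
  by (rule ext, rule partial_eqI) (intro DERIV_sum real_derivative_partial assms)

lemma differentiable_on_cmult:
  fixes f :: "real^'n::finite \<Rightarrow> real"
  shows "f differentiable_on S \<Longrightarrow> (\<lambda>x. c * f x) differentiable_on S"
  by (intro differentiable_on_mult differentiable_on_const)

lemma C1_differentiable: "C1 f \<Longrightarrow> f differentiable_on UNIV"
  by (simp add: C1_def)

lemma C1_continuous: "C1 f \<Longrightarrow> continuous_on S f"
  by (meson C1_differentiable continuous_on_subset differentiable_imp_continuous_on subset_UNIV)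

lemma C1_partial_continuous: "C1 f \<Longrightarrow> continuous_on S (partial j f)"
  unfolding C1_def by (meson continuous_on_subset subset_UNIV)

lemma C2_C1: "C2 f \<Longrightarrow> C1 f"
  by (simp add: C2_def)

lemma C2_partial: "C2 f \<Longrightarrow> C1 (partial j f)"
  by (simp add: C2_def)

lemma C1_const [simp]: "C1 (\<lambda>x. c)"
  by (simp add: C1_def)

lemma C2_const [simp]: "C2 (\<lambda>x. c)"
  by (simp add: C2_def)

lemma C1_add: "C1 f \<Longrightarrow> C1 g \<Longrightarrow> C1 (\<lambda>x. f x + g x)"
  by (auto simp: C1_def partial_add intro!: differentiable_on_add continuous_intros)

lemma C1_cmult: "C1 f \<Longrightarrow> C1 (\<lambda>x. c * f x)"
  by (auto simp: C1_def partial_cmult intro!: differentiable_on_cmult continuous_intros)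

lemma C1_mult: "C1 f \<Longrightarrow> C1 g \<Longrightarrow> C1 (\<lambda>x. f x * g x)"
  by (auto simp: C1_def partial_mult intro!: differentiable_on_mult continuous_on_add continuous_on_mult
      intro: differentiable_imp_continuous_on)

lemma C1_sum:
  assumes "finite A" "\<And>i. i \<in> A \<Longrightarrow> C1 (f i)"
  shows "C1 (\<lambda>x. \<Sum>i\<in>A. f i x)"
  using assms by (induction A rule: finite_induct) (auto intro: C1_add)

lemma C2_add: "C2 f \<Longrightarrow> C2 g \<Longrightarrow> C2 (\<lambda>x. f x + g x)"
  by (auto simp: C2_def partial_add C1_differentiable intro!: C1_add)

lemma C2_cmult: "C2 f \<Longrightarrow> C2 (\<lambda>x. c * f x)"
  by (auto simp: C2_def partial_cmult C1_differentiable intro!: C1_cmult)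

lemma constant_if_partials_zero:
  fixes f :: "real^'n::finite \<Rightarrow> real"
  assumes f: "f differentiable_on UNIV" and zero: "\<And>j x. partial j f x = 0"
  shows "\<exists>c. \<forall>x. f x = c"
proof -
  have "(f has_derivative (\<lambda>h. 0)) (at x)" for x
  proof -
    obtain D where D: "(f has_derivative D) (at x)"
      using f by (auto simp: differentiable_on_def differentiable_def)
    have linD: "linear D" using D by (rule has_derivative_linear)
    have ax: "D (axis j 1) = 0" for j
      using partial_frechet[OF D] zero by metis
    have "D h = 0" for h
    proof -
      have "D h = D (\<Sum>j\<in>UNIV. (h $ j) *\<^sub>R axis j 1)"
        by (simp add: basis_expansion scalar_mult_eq_scaleR[symmetric])
      also have "\<dots> = 0"
        by (simp add: linear_sum[OF linD] linear_cmul[OF linD] ax)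
      finally show ?thesis .
    qed
    with D show ?thesis by (metis ext)
  qed
  then have "\<exists>c. \<forall>x\<in>UNIV. f x = c"
    by (intro has_derivative_zero_constant) auto
  then show ?thesis by auto
qed

section \<open>Periodic functions and Liouville's theorem\<close>

abbreviation (input) periodic_cell :: "real \<Rightarrow> real^'n::finite \<Rightarrow> (real^'n) set"
  where "periodic_cell L a \<equiv> cbox a (a + (\<chi> j. L))"

text \<open>Moving the cell by \<open>t\<close> in direction \<open>j\<close> removes a slab of thickness \<open>t\<close> on one side and
adds one on the opposite side; the slabs differ by a translation by a full period. This single fact
replaces Fubini's theorem below, both for integration by parts and for the orthogonality of
plane waves.\<close>
lemma integral_periodic_translate:
  fixes f :: "real^'n::finite \<Rightarrow> 'b::banach"
  assumes cont: "continuous_on UNIV f" and per: "periodic L f" and t: "0 \<le> t" "t \<le> L"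
  shows "integral (periodic_cell L a) (\<lambda>x. f (x + t *\<^sub>R axis j 1)) = integral (periodic_cell L a) f"
proof -
  let ?e = "axis j 1 :: real^'n"
  let ?b = "a + (\<chi> j. L)"
  have e: "?e \<in> Basis" by (simp add: axis_in_Basis_iff)
  have int: "f integrable_on cbox u v" for u v
    using cont integrable_continuous continuous_on_subset by blast
  define m where "m = a + t *\<^sub>R ?e"
  define slab where "slab = cbox a (\<chi> i. if i = j then a $ j + t else a $ i + L)"
  define middle where "middle = cbox m ?b"
  define slab' where "slab' = cbox (\<chi> i. if i = j then a $ j + L else a $ i) (?b + t *\<^sub>R ?e)"
  have mem_cell: "x \<in> cbox u v \<longleftrightarrow>
      (u $ j \<le> x $ j \<and> x $ j \<le> v $ j) \<and> (\<forall>i. i \<noteq> j \<longrightarrow> u $ i \<le> x $ i \<and> x $ i \<le> v $ i)"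
    for x u v :: "real^'n"
    unfolding mem_box_cart by metis
  have lower: "cbox a ?b \<inter> {x. x \<bullet> ?e \<le> a $ j + t} = slab"
    and upper: "cbox a ?b \<inter> {x. x \<bullet> ?e \<ge> a $ j + t} = middle"
    and lower': "cbox m (?b + t *\<^sub>R ?e) \<inter> {x. x \<bullet> ?e \<le> a $ j + L} = middle"
    and upper': "cbox m (?b + t *\<^sub>R ?e) \<inter> {x. x \<bullet> ?e \<ge> a $ j + L} = slab'"
    unfolding slab_def middle_def slab'_def m_def set_eq_iff Int_iff mem_cell mem_Collect_eq inner_axis
    using t by (auto simp: axis_def)
  have shift: "integral slab' f = integral slab f"
  proof -
    have "integral slab (f \<circ> (+) (L *\<^sub>R ?e)) = integral slab' f"
      unfolding slab_def slab'_def integral_shift_cbox_plus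
      by (rule arg_cong2[where f = integral], rule arg_cong2[where f = cbox])
         (auto simp: vec_eq_iff axis_def)
    moreover have "f \<circ> (+) (L *\<^sub>R ?e) = f"
      using per by (auto simp: periodic_def add.commute fun_eq_iff)
    ultimately show ?thesis by simp
  qed
  have "integral (cbox a ?b) (\<lambda>x. f (x + t *\<^sub>R ?e)) = integral (cbox m (?b + t *\<^sub>R ?e)) f"
    unfolding m_def integral_shift_cbox_plus[symmetric] by (simp add: o_def add.commute)
  also have "\<dots> = integral middle f + integral slab' f"
    using integral_split[OF int e, of m "?b + t *\<^sub>R ?e" "a $ j + L"] by (simp only: lower' upper')
  also have "\<dots> = integral (cbox a ?b) f"
    using integral_split[OF int e, of a ?b "a $ j + t"] by (simp only: lower upper shift add.commute[of "integral middle f"])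
  finally show ?thesis .
qed

text \<open>The integral of \<open>f\<close> over the translated cell does not depend on the translation; differentiate
it under the integral sign.\<close>
lemma integral_partial_periodic:
  fixes f :: "real^'n::finite \<Rightarrow> real"
  assumes C1: "C1 f" and per: "periodic L f" and L: "L > 0"
  shows "(partial j f has_integral 0) (periodic_cell L a)"
proof -
  let ?e = "axis j 1 :: real^'n"
  let ?I = "\<lambda>t. integral (periodic_cell L a) (\<lambda>x. f (x + t *\<^sub>R ?e))"
  have int: "(\<lambda>x. f (x + t *\<^sub>R ?e)) integrable_on periodic_cell L a" for t
    by (intro integrable_continuous continuous_on_compose2[OF C1_continuous[OF C1, of UNIV]] continuous_intros) auto
  have cont: "continuous_on ({0..L} \<times> periodic_cell L a) (\<lambda>(t, x). partial j f (x + t *\<^sub>R ?e))"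
    unfolding split_beta
    by (intro continuous_on_compose2[OF C1_partial_continuous[OF C1, of UNIV]] continuous_intros) auto
  have "(?I has_vector_derivative integral (periodic_cell L a) (\<lambda>x. partial j f (x + 0 *\<^sub>R ?e))) (at 0 within {0..L})"
    by (rule leibniz_rule_vector_derivative[where f = "\<lambda>t x. f (x + t *\<^sub>R ?e)" and fx = "\<lambda>t x. partial j f (x + t *\<^sub>R ?e)"])
       (use L in \<open>auto intro!: int cont real_derivative_along_axis C1_differentiable[OF C1]
          simp: has_real_derivative_iff_has_vector_derivative[symmetric]\<close>)
  moreover have "(?I has_vector_derivative 0) (at 0 within {0..L})"
  proof (rule has_vector_derivative_transform)
    show "((\<lambda>t. integral (periodic_cell L a) f) has_vector_derivative 0) (at 0 within {0..L})"
      by simp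
    show "?I t = integral (periodic_cell L a) f" if "t \<in> {0..L}" for t
      using that by (intro integral_periodic_translate C1_continuous C1 per) auto
  qed (use L in auto)
  ultimately have "integral (periodic_cell L a) (partial j f) = 0"
    using vector_derivative_unique_within[of 0 "{0..L}"] L
    by (simp add: trivial_limit_within islimpt_Icc)
  moreover have "partial j f integrable_on periodic_cell L a"
    by (intro integrable_continuous C1_partial_continuous C1)
  ultimately show ?thesis by (simp add: has_integral_iff)
qed

lemma periodic_partial:
  fixes f :: "real^'n::finite \<Rightarrow> real"
  assumes "periodic L f"
  shows "periodic L (partial j f)"
proof -
  have "f (x + L *\<^sub>R axis i 1 + s *\<^sub>R axis j 1) = f (x + s *\<^sub>R axis j 1)" for x i s
    using assms[unfolded periodic_def, rule_format, of "x + s *\<^sub>R axis j 1" i] by (simp add: add_ac)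
  then show ?thesis by (simp add: periodic_def partial_def)
qed

lemma periodic_mult: "periodic L f \<Longrightarrow> periodic L g \<Longrightarrow> periodic L (\<lambda>x. f x * g x)"
  by (simp add: periodic_def)

text \<open>Energy argument: integrating \<open>\<partial>\<^sub>j(p \<partial>\<^sub>jp) = (\<partial>\<^sub>jp)\<^sup>2 + p \<partial>\<^sub>j\<^sup>2p\<close> over a cell and summing over
\<open>j\<close> gives \<open>\<integral>|\<nabla>p|\<^sup>2 = 0\<close>.\<close>
lemma periodic_harmonic_constant:
  fixes p :: "real^'n::finite \<Rightarrow> real"
  assumes C2: "C2 p" and per: "periodic L p" and L: "L > 0" and harm: "\<And>x. laplacian p x = 0"
  shows "\<exists>c. \<forall>x. p x = c"
proof (rule constant_if_partials_zero)
  have C1: "C1 p" and C1': "C1 (partial j p)" for j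
    using C2 by (auto intro: C2_C1 C2_partial)
  show "p differentiable_on UNIV" using C1 by (rule C1_differentiable)
  fix j a
  have flux: "partial j (\<lambda>x. p x * partial j p x) =
      (\<lambda>x. (partial j p x)\<^sup>2 + p x * partial j (partial j p) x)" for j
    by (simp add: partial_mult C1_differentiable C1 C1' power2_eq_square)
  have "((\<lambda>x. \<Sum>j\<in>UNIV. partial j (\<lambda>x. p x * partial j p x) x) has_integral (\<Sum>j\<in>(UNIV::'n set). 0)) (periodic_cell L a)"
    by (intro has_integral_sum integral_partial_periodic C1_mult periodic_mult periodic_partial C1 C1' per L) auto
  moreover have "(\<Sum>j\<in>UNIV. partial j (\<lambda>x. p x * partial j p x) x) = (\<Sum>j\<in>UNIV. (partial j p x)\<^sup>2)" for x
    using harm[of x] unfolding flux by (simp add: sum.distrib sum_distrib_left[symmetric] laplacian_def)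
  ultimately have energy: "((\<lambda>x. \<Sum>j\<in>UNIV. (partial j p x)\<^sup>2) has_integral 0) (periodic_cell L a)"
    by simp
  have "(\<Sum>j\<in>UNIV. (partial j p a)\<^sup>2) = 0"
  proof (rule has_integral_0_cbox_imp_0[OF _ _ energy])
    show "continuous_on (periodic_cell L a) (\<lambda>x. \<Sum>j\<in>UNIV. (partial j p x)\<^sup>2)"
      by (intro continuous_intros C1_partial_continuous C1)
    show "box a (a + (\<chi> j. L)) \<noteq> {}" "a \<in> periodic_cell L a"
      using L by (auto simp: mem_box_cart interval_ne_empty_cart)
  qed (auto intro: sum_nonneg)
  then show "partial j p a = 0"
    by (simp add: sum_nonneg_eq_0_iff)
qed

lemma purely_transverseI:
  fixes u :: "real^'n::finite \<Rightarrow> real^'n"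
  assumes L: "L > 0" and div: "divergence_free u"
  shows "purely_transverse L u"
proof -
  have "is_longitudinal_part L u w \<longleftrightarrow> w = (\<lambda>x. 0)" for w
  proof
    assume "is_longitudinal_part L u w"
    then obtain \<phi> where "C2 \<phi>" "periodic L \<phi>" "\<And>x. laplacian \<phi> x = 0" and w: "w = gradient \<phi>"
      using div by (auto simp: is_longitudinal_part_def divergence_free_def)
    then obtain c where "\<And>x. \<phi> x = c"
      using periodic_harmonic_constant L by blast
    then have \<phi>: "\<phi> = (\<lambda>x. c)" by auto
    show "w = (\<lambda>x. 0)"
      unfolding w \<phi> by (simp add: gradient_def fun_eq_iff vec_eq_iff)
  next
    assume "w = (\<lambda>x. 0)"
    then show "is_longitudinal_part L u w"
      using div unfolding is_longitudinal_part_def divergence_free_def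
      by (intro exI[of _ "\<lambda>x. 0"]) (auto simp: periodic_def laplacian_def gradient_def fun_eq_iff vec_eq_iff)
  qed
  with div show ?thesis by (simp add: purely_transverse_def)
qed

section \<open>Periodic solenoidal gradients\<close>

lemma partial_coordinate: "partial j (\<lambda>x::real^'n::finite. x $ i) = (\<lambda>x. if i = j then 1 else 0)"
  by (rule ext, rule partial_eqI) (auto simp: axis_def intro!: derivative_eq_intros)

lemma C1_coordinate: "C1 (\<lambda>x::real^'n::finite. x $ i)"
  by (auto simp: C1_def partial_coordinate intro!: linear_imp_differentiable_on bounded_linear.linear[OF bounded_linear_vec_nth])

lemma C2_linear: "C2 (\<lambda>x::real^'n::finite. \<Sum>i\<in>UNIV. k i * x $ i)"
  and partial_linear: "partial j (\<lambda>x::real^'n::finite. \<Sum>i\<in>UNIV. k i * x $ i) = (\<lambda>x. k j)"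
proof -
  have diff: "(\<lambda>x::real^'n. k i * x $ i) differentiable_on UNIV" for i
    by (intro differentiable_on_cmult C1_differentiable C1_coordinate)
  show *: "partial j (\<lambda>x::real^'n::finite. \<Sum>i\<in>UNIV. k i * x $ i) = (\<lambda>x. k j)" for j
    by (simp add: partial_sum diff partial_cmult C1_differentiable[OF C1_coordinate] partial_coordinate
        if_distrib[of "(*) _"] cong: if_cong)
  show "C2 (\<lambda>x::real^'n::finite. \<Sum>i\<in>UNIV. k i * x $ i)"
    unfolding C2_def * by (auto intro!: C1_sum C1_cmult C1_coordinate)
qed

text \<open>The increment \<open>\<phi>(x + L e\<^sub>j) - \<phi>(x)\<close> of a potential has gradient zero, hence is a constant
\<open>k\<^sub>j\<close>. Subtracting the linear function with slopes \<open>k\<^sub>j/L\<close> makes \<open>\<phi>\<close> periodic without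
changing its Laplacian, and Liouville's theorem applies.\<close>
lemma periodic_divergence_free_gradient_constant:
  fixes u :: "real^'n::finite \<Rightarrow> real^'n"
  assumes div: "divergence_free u" and per: "periodic L u" and L: "L > 0" and grad: "is_gradient u"
  shows "\<exists>c. \<forall>x. u x = c"
proof -
  obtain \<phi> where diff: "\<phi> differentiable_on UNIV" and u: "\<And>x. u x = gradient \<phi> x"
    using grad by (auto simp: is_gradient_def)
  have part: "partial j \<phi> = (\<lambda>x. u x $ j)" for j
    by (simp add: u gradient_def)
  have C1u: "C1 (\<lambda>x. u x $ j)" for j
    using div by (simp add: divergence_free_def)
  have C2\<phi>: "C2 \<phi>"
    unfolding C2_def part using C1u diff by (auto simp: C1_def[of \<phi>] part intro: C1_continuous)
  have "\<exists>c. \<forall>x. \<phi> (x + L *\<^sub>R axis j 1) - \<phi> x = c" for j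
  proof (rule constant_if_partials_zero)
    let ?T = "\<lambda>x. x + L *\<^sub>R axis j (1::real) :: real^'n"
    have "?T differentiable_on UNIV" "\<phi> differentiable_on range ?T"
      using diff by (auto intro: differentiable_on_subset)
    then have "(\<lambda>x. \<phi> (?T x)) differentiable_on UNIV"
      by (rule differentiable_on_compose)
    then show "(\<lambda>x. \<phi> (?T x) - \<phi> x) differentiable_on UNIV"
      using diff by (rule differentiable_on_diff)
    fix i x
    show "partial i (\<lambda>x. \<phi> (?T x) - \<phi> x) x = 0"
    proof (rule partial_eqI)
      have "((\<lambda>s. \<phi> (?T x + s *\<^sub>R axis i 1) - \<phi> (x + s *\<^sub>R axis i 1)) has_real_derivative
          partial i \<phi> (?T x) - partial i \<phi> x) (at 0)"
        by (intro DERIV_diff real_derivative_partial diff)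
      then show "((\<lambda>s. \<phi> (x + s *\<^sub>R axis i 1 + L *\<^sub>R axis j 1) - \<phi> (x + s *\<^sub>R axis i 1)) has_real_derivative 0) (at 0)"
        using per by (simp add: part periodic_def add_ac)
    qed
  qed
  then obtain k where k: "\<And>j x. \<phi> (x + L *\<^sub>R axis j 1) - \<phi> x = k j"
    by metis
  define \<psi> where "\<psi> x = \<phi> x + (\<Sum>i\<in>UNIV. (- k i / L) * x $ i)" for x
  have lin: "C2 (\<lambda>x::real^'n. \<Sum>i\<in>UNIV. (- k i / L) * x $ i)"
    by (rule C2_linear)
  have C2\<psi>: "C2 \<psi>"
    unfolding \<psi>_def by (intro C2_add C2\<phi> lin)
  have part\<psi>: "partial j \<psi> = (\<lambda>x. u x $ j - k j / L)" for j
    unfolding \<psi>_def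
    by (subst partial_add[OF diff C1_differentiable[OF C2_C1[OF lin]]]) (simp only: part partial_linear, simp)
  have "periodic L \<psi>"
    unfolding periodic_def
  proof (intro allI)
    fix x j
    have "(\<Sum>i\<in>UNIV. (- k i / L) * (x + L *\<^sub>R axis j 1) $ i) = (\<Sum>i\<in>UNIV. (- k i / L) * x $ i) - k j"
    proof -
      have "(- k i / L) * (x + L *\<^sub>R axis j 1) $ i = (- k i / L) * x $ i + (if i = j then - k j else 0)" for i
        using L by (auto simp: axis_def distrib_left)
      then show ?thesis by (simp only: sum.distrib) simp
    qed
    with k[of x j] show "\<psi> (x + L *\<^sub>R axis j 1) = \<psi> x"
      by (simp add: \<psi>_def)
  qed
  moreover have "laplacian \<psi> x = 0" for x
  proof -
    have "partial j (\<lambda>x. u x $ j - k j / L) = partial j (\<lambda>x. u x $ j)" for j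
      using partial_add[OF C1_differentiable[OF C1u] differentiable_on_const[of "- k j / L"], of j j]
      by simp
    then show ?thesis
      using div by (simp add: laplacian_def part\<psi> divergence_free_def divergence_def)
  qed
  ultimately obtain c where "\<And>x. \<psi> x = c"
    using periodic_harmonic_constant[OF C2\<psi> _ L] by auto
  then have "partial j \<psi> = (\<lambda>x. 0)" for j
    by (metis ext partial_const)
  then have "u x = (\<chi> j. k j / L)" for x
    by (simp add: part\<psi> fun_eq_iff vec_eq_iff)
  then show ?thesis by blast
qed

section \<open>Trigonometric polynomials and their Fourier series\<close>

lemma wave_phase_add: "wave_phase L (k + l) x = wave_phase L k x + wave_phase L l x"
  by (simp add: wave_phase_def distrib_right sum.distrib distrib_left)

lemma wave_phase_uminus: "wave_phase L (- k) x = - wave_phase L k x"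
  by (simp add: wave_phase_def sum_negf)

lemma wave_phase_diff: "wave_phase L (k - l) x = wave_phase L k x - wave_phase L l x"
  using wave_phase_add[of L k "- l"] by (simp add: wave_phase_uminus)

lemma wave_phase_translate:
  "wave_phase L k (x + t *\<^sub>R axis j 1) = wave_phase L k x + 2 * pi / L * (of_int (k $ j) * t)"
proof -
  have "of_int (k $ i) * (x + t *\<^sub>R axis j 1) $ i
      = of_int (k $ i) * x $ i + (if i = j then of_int (k $ j) * t else 0)" for i
    by (auto simp: axis_def distrib_left)
  then show ?thesis by (simp add: wave_phase_def sum.distrib distrib_left)
qed

lemma continuous_on_wave_phase [continuous_intros]: "continuous_on S (wave_phase L k)"
  unfolding wave_phase_def by (intro continuous_intros)

text \<open>If \<open>k\<^sub>j \<noteq> 0\<close>, translation by half a wavelength in direction \<open>j\<close> changes the sign of the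
wave but not its integral.\<close>
lemma integral_cis_wave_phase:
  fixes k :: "int^'n::finite"
  assumes L: "L > 0"
  shows "integral (cbox 0 (\<chi> j. L)) (\<lambda>x. cis (wave_phase L k x)) = (if k = 0 then of_real (L ^ CARD('n)) else 0)"
proof (cases "k = 0")
  case True
  have "(0::real^'n) \<in> cbox 0 (\<chi> j. L)" using L by (simp add: mem_box_cart)
  then have "measure lborel (cbox 0 (\<chi> j. L) :: (real^'n) set) = L ^ CARD('n)"
    by (subst content_cbox_cart) auto
  with True show ?thesis
    by (simp add: wave_phase_def scaleR_conv_of_real)
next
  case False
  then obtain j where j: "k $ j \<noteq> 0" by (auto simp: vec_eq_iff)
  define t where "t = L / (2 * of_int \<bar>k $ j\<bar>)"
  have t: "0 \<le> t" "t \<le> L"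
    using L j by (auto simp: t_def field_simps)
  have shift: "cis (wave_phase L k (x + t *\<^sub>R axis j 1)) = - cis (wave_phase L k x)" for x
  proof -
    have "2 * pi / L * (of_int (k $ j) * t) = pi \<or> 2 * pi / L * (of_int (k $ j) * t) = - pi"
      using L j by (auto simp: t_def field_simps abs_if)
    then show ?thesis
      by (auto simp: wave_phase_translate complex_eq_iff cos_add sin_add)
  qed
  have per: "periodic L (\<lambda>x. cis (wave_phase L k x))"
    unfolding periodic_def wave_phase_translate cis_mult[symmetric]
    using L cis_multiple_2pi[of "of_int (k $ j)" for j] by (simp add: mult.assoc)
  have "integral (periodic_cell L 0) (\<lambda>x. cis (wave_phase L k (x + t *\<^sub>R axis j 1))) =
      integral (periodic_cell L 0) (\<lambda>x. cis (wave_phase L k x))"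
    by (rule integral_periodic_translate[OF _ per t])
       (auto intro!: continuous_intros)
  with False show ?thesis by (simp add: shift)
qed

text \<open>Real trigonometric polynomials whose wave numbers belong to \<open>K\<close>. The free phase \<open>b\<close> covers
sines and cosines at once and makes the class visibly invariant under translations.\<close>
inductive trig_poly :: "real \<Rightarrow> (int^'n::finite) set \<Rightarrow> (real^'n \<Rightarrow> real) \<Rightarrow> bool"
  for L :: real and K :: "(int^'n::finite) set"
  where
    wave: "k \<in> K \<Longrightarrow> trig_poly L K (\<lambda>x. cos (wave_phase L k x + b))"
  | add: "trig_poly L K f \<Longrightarrow> trig_poly L K g \<Longrightarrow> trig_poly L K (\<lambda>x. f x + g x)"
  | scale: "trig_poly L K f \<Longrightarrow> trig_poly L K (\<lambda>x. c * f x)"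

lemma trig_poly_sum:
  assumes "finite A" "A \<noteq> {}" "\<And>i. i \<in> A \<Longrightarrow> trig_poly L K (f i)"
  shows "trig_poly L K (\<lambda>x. \<Sum>i\<in>A. f i x)"
  using assms by (induction A rule: finite_ne_induct) (auto intro: trig_poly.add)

lemma trig_poly_mult:
  assumes f: "trig_poly L K f" and g: "trig_poly L M g"
    and modes: "\<And>k m. k \<in> K \<Longrightarrow> m \<in> M \<Longrightarrow> k + m \<in> N \<and> k - m \<in> N"
  shows "trig_poly L N (\<lambda>x. f x * g x)"
  using f
proof induction
  case (wave k b)
  from g show ?case
  proof induction
    case (wave m c)
    have prod: "cos (wave_phase L k x + b) * cos (wave_phase L m x + c) =
        1/2 * cos (wave_phase L (k - m) x + (b - c)) + 1/2 * cos (wave_phase L (k + m) x + (b + c))" for x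
      by (simp add: cos_times_cos wave_phase_add wave_phase_diff algebra_simps add_divide_distrib)
    show ?case
      unfolding prod using modes[OF \<open>k \<in> K\<close> \<open>m \<in> M\<close>]
      by (intro trig_poly.add trig_poly.scale trig_poly.wave) auto
  next
    case (add g h)
    then show ?case by (simp add: distrib_left trig_poly.add)
  next
    case (scale g c)
    then show ?case by (simp add: mult.left_commute trig_poly.scale)
  qed
next
  case (add f h)
  then show ?case by (simp add: distrib_right trig_poly.add)
next
  case (scale f c)
  then show ?case by (simp add: mult.assoc trig_poly.scale)
qed

lemma trig_poly_continuous:
  "trig_poly L K f \<Longrightarrow> continuous_on S f"
  by (induction rule: trig_poly.induct) (auto intro!: continuous_intros)

lemma fourier_coeff_wave:
  assumes L: "L > 0"
  shows "fourier_coeff L (\<lambda>x. cos (wave_phase L m x + b)) k =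
    (if k = m then cis b / 2 else 0) + (if k = - m then cis (- b) / 2 else 0)"
proof -
  let ?B = "cbox 0 (\<chi> j. L) :: (real^'n) set"
  have expand: "of_real (cos (wave_phase L m x + b)) * cis (- wave_phase L k x) =
      cis b / 2 * cis (wave_phase L (m - k) x) + cis (- b) / 2 * cis (wave_phase L (- m - k) x)" for x
    unfolding complex_eq_iff wave_phase_diff wave_phase_uminus
    by (simp add: cos_add sin_add cos_diff sin_diff field_simps)
  have "integral ?B (\<lambda>x. of_real (cos (wave_phase L m x + b)) * cis (- wave_phase L k x)) =
      cis b / 2 * integral ?B (\<lambda>x. cis (wave_phase L (m - k) x)) +
      cis (- b) / 2 * integral ?B (\<lambda>x. cis (wave_phase L (- m - k) x))"
    unfolding expand
    by (intro integral_unique has_integral_add has_integral_mult_right integrable_integral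
        integrable_continuous continuous_intros)
  then show ?thesis
    unfolding fourier_coeff_def integral_cis_wave_phase[OF L] using L right_minus_eq[of "- m" k]
    by (simp add: add_divide_distrib eq_commute[of k])
qed

lemma fourier_coeff_add:
  assumes "continuous_on UNIV f" "continuous_on UNIV g"
  shows "fourier_coeff L (\<lambda>x. f x + g x) k = fourier_coeff L f k + fourier_coeff L g k"
proof -
  have "(\<lambda>x. of_real (h x) * cis (- wave_phase L k x)) integrable_on cbox 0 (\<chi> j. L)"
    if "continuous_on UNIV h" for h
    by (intro integrable_continuous continuous_intros continuous_on_subset[OF that]) auto
  with assms show ?thesis
    by (simp add: fourier_coeff_def distrib_right integral_add add_divide_distrib)
qed

lemma fourier_coeff_cmult: "fourier_coeff L (\<lambda>x. c * f x) k = of_real c * fourier_coeff L f k"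
  by (simp add: fourier_coeff_def mult.assoc)

text \<open>Translation by a quarter period in direction \<open>i\<close> multiplies a mode with \<open>k\<^sub>i = \<plusminus>2\<close> by \<open>-1\<close> and
fixes a mode with \<open>k\<^sub>i = 0\<close>. So the average over the two points keeps precisely the
\<open>x\<^sub>i\<close>-independent part, and no Fourier coefficient of the given field has to be computed.\<close>
lemma independent_part_trig_poly:
  fixes f :: "real^'n::finite \<Rightarrow> real"
  assumes L: "L > 0" and f: "trig_poly L K f" and K: "\<And>k. k \<in> K \<Longrightarrow> k $ i \<in> {-2, 0, 2}"
  shows "independent_part L i f x = of_real ((f x + f (x + (L/4) *\<^sub>R axis i 1)) / 2)"
proof -
  have "((\<lambda>k. fourier_coeff L f k * cis (wave_phase L k x)) has_sum
      of_real ((f x + f (x + (L/4) *\<^sub>R axis i 1)) / 2)) {k. k $ i = 0}"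
    using f
  proof induction
    case (wave m b)
    let ?e = "\<lambda>k. cis (wave_phase L k x)"
    have single: "((\<lambda>k. if k = l then c else 0) has_sum (if l $ i = 0 then c else 0)) {k. k $ i = 0}"
      for l :: "int^'n" and c :: complex
      by (rule has_sum_finite_neutralI[of "{l} \<inter> {k. k $ i = 0}"]) auto
    have mode: "fourier_coeff L (\<lambda>x. cos (wave_phase L m x + b)) k * ?e k =
        (if k = m then cis b / 2 * ?e m else 0) + (if k = - m then cis (- b) / 2 * ?e (- m) else 0)" for k
      unfolding fourier_coeff_wave[OF L] distrib_right
      by (intro arg_cong2[where f = "(+)"]) auto
    have "cis b / 2 * ?e m + cis (- b) / 2 * ?e (- m) = of_real (cos (wave_phase L m x + b))"
      by (simp add: complex_eq_iff wave_phase_uminus cos_add sin_add field_simps)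
    then have sum: "(if m $ i = 0 then cis b / 2 * ?e m else 0) + (if (- m) $ i = 0 then cis (- b) / 2 * ?e (- m) else 0)
        = (if m $ i = 0 then of_real (cos (wave_phase L m x + b)) else 0)"
      by simp
    have "cos (wave_phase L m (x + (L/4) *\<^sub>R axis i 1) + b) =
       (if m $ i = 0 then 1 else - 1) * cos (wave_phase L m x + b)"
      using K[OF wave] L unfolding wave_phase_translate
      by (auto simp: cos_add sin_add)
    then show ?case
      using has_sum_add[OF single[of m "cis b / 2 * ?e m"] single[of "- m" "cis (- b) / 2 * ?e (- m)"]]
      unfolding mode sum by (auto split: if_splits)
  next
    case (add f g)
    then show ?case
      using has_sum_add[OF add.IH] fourier_coeff_add[OF trig_poly_continuous trig_poly_continuous, OF add.hyps]
      by (simp add: distrib_right add_divide_distrib add_ac)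
  next
    case (scale f c)
    then show ?case
      using has_sum_cmult_right[OF scale.IH, of "of_real c"]
      by (simp add: fourier_coeff_cmult distrib_left mult.assoc)
  qed
  then show ?thesis
    unfolding independent_part_def by (rule infsumI)
qed

lemma reduction_condition_zero: "reduction_condition L (\<lambda>x. 0)"
  by (simp add: reduction_condition_def independent_part_def fourier_coeff_def)

section \<open>Solenoidal flows composed of unit modes\<close>

text \<open>Outside \<open>S\<close> the wave numbers vanish, so that a product of sinusoids in distinct coordinates can
be built up one coordinate at a time; the modes of the complete product are \<open>unit_modes UNIV\<close>.\<close>
definition unit_modes :: "'n set \<Rightarrow> (int^'n::finite) set" where
  "unit_modes S = {k. \<forall>j. (j \<in> S \<longrightarrow> k $ j \<in> {-1, 1}) \<and> (j \<notin> S \<longrightarrow> k $ j = 0)}"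

lemma trig_poly_const: "trig_poly L (unit_modes {}) (\<lambda>x. c)"
proof -
  have "0 \<in> (unit_modes {} :: (int^'n::finite) set)" by (simp add: unit_modes_def)
  from trig_poly.scale[OF trig_poly.wave[OF this, of L 0], of c] show ?thesis
    by (simp add: wave_phase_def)
qed

lemma trig_poly_mult_sin:
  fixes f :: "real^'n::finite \<Rightarrow> real"
  assumes f: "trig_poly (2 * pi / \<alpha>) (unit_modes S) f" and m: "m \<notin> S" and \<alpha>: "\<alpha> > 0"
  shows "trig_poly (2 * pi / \<alpha>) (unit_modes (insert m S)) (\<lambda>x. f x * sin (\<alpha> * x $ m + b))"
proof (rule trig_poly_mult[OF f, where M = "{axis m 1}"])
  have "(\<Sum>j\<in>UNIV. real_of_int (axis m 1 $ j) * x $ j) = x $ m" for x :: "real^'n"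
    by (simp add: axis_def if_distrib[of real_of_int] if_distrib[of "\<lambda>z. z * _"] cong: if_cong)
  then have phase: "wave_phase (2 * pi / \<alpha>) (axis m 1) x = \<alpha> * x $ m" for x :: "real^'n"
    using \<alpha> by (simp add: wave_phase_def)
  have "cos (\<alpha> * x $ m + (b - pi / 2)) = sin (\<alpha> * x $ m + b)" for x :: "real^'n"
    unfolding add_diff_eq by (simp add: cos_diff)
  then show "trig_poly (2 * pi / \<alpha>) {axis m 1} (\<lambda>x. sin (\<alpha> * x $ m + b))"
    using trig_poly.wave[of "axis m 1" "{axis m 1}" "2 * pi / \<alpha>" "b - pi / 2"] by (simp add: phase)
next
  fix k l
  assume k: "k \<in> unit_modes S" and l: "l \<in> {axis m (1::int)}"
  have "k $ m = 0" using k m by (simp add: unit_modes_def)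
  then show "k + l \<in> unit_modes (insert m S) \<and> k - l \<in> unit_modes (insert m S)"
    using k l by (auto simp: unit_modes_def axis_def)
qed

lemma trig_poly_mult_cos:
  fixes f :: "real^'n::finite \<Rightarrow> real"
  assumes f: "trig_poly (2 * pi / \<alpha>) (unit_modes S) f" and m: "m \<notin> S" and \<alpha>: "\<alpha> > 0"
  shows "trig_poly (2 * pi / \<alpha>) (unit_modes (insert m S)) (\<lambda>x. f x * cos (\<alpha> * x $ m + b))"
  using trig_poly_mult_sin[OF assms, of "b + pi / 2"] by (simp add: sin_add add.assoc[symmetric])

lemma wave_shift_quarter:
  assumes "L > 0"
  shows "wave_phase L k (x + (L/4) *\<^sub>R axis j 1) = wave_phase L k x + of_int (k $ j) * (pi / 2)"
  using assms by (simp add: wave_phase_translate)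

lemma trig_poly_translate:
  "trig_poly L K f \<Longrightarrow> trig_poly L K (\<lambda>x. f (x + t *\<^sub>R axis j 1))"
proof (induction rule: trig_poly.induct)
  case (wave k b)
  then show ?case
    using trig_poly.wave[OF wave, of L "2 * pi / L * (of_int (k $ j) * t) + b"]
    by (simp add: wave_phase_translate add.assoc)
qed (auto intro: trig_poly.intros)

text \<open>For \<open>k\<^sub>j = \<plusminus>1\<close> a quarter period shifts the phase by \<open>\<plusminus>\<pi>/2\<close>, which is what differentiation does
to a cosine, the sign included.\<close>
lemma
  fixes f :: "real^'n::finite \<Rightarrow> real"
  assumes L: "L > 0" and f: "trig_poly L (unit_modes UNIV) f"
  shows unit_trig_poly_differentiable: "f differentiable_on UNIV"
    and unit_trig_poly_partial: "partial j f = (\<lambda>x. 2 * pi / L * f (x + (L/4) *\<^sub>R axis j 1))"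
    and unit_trig_poly_half_period: "f (x + (L/4) *\<^sub>R axis j 1 + (L/4) *\<^sub>R axis j 1) = - f x"
proof -
  have "f differentiable_on UNIV \<and> partial j f = (\<lambda>x. 2 * pi / L * f (x + (L/4) *\<^sub>R axis j 1))
      \<and> f (x + (L/4) *\<^sub>R axis j 1 + (L/4) *\<^sub>R axis j 1) = - f x"
    using f
  proof induction
    case (wave k b)
    then have k: "k $ j = 1 \<or> k $ j = - 1" for j by (auto simp: unit_modes_def)
    have "(wave_phase L k has_derivative wave_phase L k) (at x)" for x :: "real^'n"
      unfolding wave_phase_def by (intro has_derivative_mult_right has_derivative_sum bounded_linear.has_derivative[OF bounded_linear_vec_nth]
          has_derivative_ident)
    then have diff: "((\<lambda>x. cos (wave_phase L k x + b)) has_derivative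
        (\<lambda>h. - sin (wave_phase L k x + b) * wave_phase L k h)) (at x)" for x :: "real^'n"
      by (auto intro!: derivative_eq_intros)
    have "wave_phase L k (axis j 1) = 2 * pi / L * of_int (k $ j)"
      using wave_phase_translate[of L k 0 1 j] by (simp add: wave_phase_def)
    moreover have "cos (wave_phase L k (x + (L/4) *\<^sub>R axis j 1) + b) = - sin (wave_phase L k x + b) * of_int (k $ j)"
      "cos (wave_phase L k (x + (L/4) *\<^sub>R axis j 1 + (L/4) *\<^sub>R axis j 1) + b) = - cos (wave_phase L k x + b)" for x
      using k[of j] unfolding wave_shift_quarter[OF L] by (auto simp: cos_add sin_add)
    ultimately show ?case
      using diff by (auto simp: fun_eq_iff partial_frechet[OF diff] differentiable_on_def differentiable_def)
  next
    case (add f g)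
    then show ?case by (simp add: differentiable_on_add partial_add distrib_left)
  next
    case (scale f c)
    then show ?case by (simp add: differentiable_on_cmult partial_cmult mult.left_commute)
  qed
  then show "f differentiable_on UNIV" "partial j f = (\<lambda>x. 2 * pi / L * f (x + (L/4) *\<^sub>R axis j 1))"
    "f (x + (L/4) *\<^sub>R axis j 1 + (L/4) *\<^sub>R axis j 1) = - f x" by auto
qed

text \<open>In any dimension, a solenoidal field with all wave numbers \<open>\<plusminus>1\<close> decays exponentially without
changing its shape under the force that balances its own convection. That this force is itself
solenoidal is a special property, established below for the canonical wave.\<close>
locale unit_wave_flow =
  fixes L :: real and v :: "real^'n::finite \<Rightarrow> real^'n"
  assumes L_pos: "L > 0"
    and unit_waves: "trig_poly L (unit_modes UNIV) (\<lambda>x. v x $ i)"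
    and solenoidal: "divergence v x = 0"
begin

definition wave_number where "wave_number = 2 * pi / L"

lemma partial_component: "partial j (\<lambda>x. v x $ i) = (\<lambda>x. wave_number * v (x + (L/4) *\<^sub>R axis j 1) $ i)"
  using unit_trig_poly_partial[OF L_pos unit_waves] by (simp add: wave_number_def)

lemma unit_waves_partial: "trig_poly L (unit_modes UNIV) (partial j (\<lambda>x. v x $ i))"
  unfolding partial_component by (intro trig_poly.scale trig_poly_translate unit_waves)

lemma C1_unit_waves:
  assumes "trig_poly L (unit_modes UNIV) f"
  shows "C1 f"
  unfolding C1_def unit_trig_poly_partial[OF L_pos assms]
  using unit_trig_poly_differentiable[OF L_pos assms]
    trig_poly_continuous[OF trig_poly.scale[OF trig_poly_translate[OF assms]]] by blast

lemma C2_component: "C2 (\<lambda>x. v x $ i)"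
  by (simp add: C2_def C1_unit_waves unit_waves unit_waves_partial)

lemmas C1_component = C2_C1[OF C2_component]
lemmas C1_partial_component = C2_partial[OF C2_component]
lemmas differentiable_component = C1_differentiable[OF C1_component] C1_differentiable[OF C1_partial_component]

lemma periodic_flow: "periodic L v"
proof -
  have "v (x + L *\<^sub>R axis j 1) $ i = v x $ i" for x i j
  proof -
    let ?h = "(L/4) *\<^sub>R axis j 1 :: real^'n"
    have "x + L *\<^sub>R axis j 1 = (x + ?h + ?h) + ?h + ?h"
      by (simp add: vec_eq_iff)
    then show ?thesis
      by (simp only: unit_trig_poly_half_period[OF L_pos unit_waves] minus_minus)
  qed
  then show ?thesis by (simp add: periodic_def vec_eq_iff)
qed

lemma periodic_component: "periodic L (\<lambda>x. v x $ i)"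
  using periodic_flow by (simp add: periodic_def)

lemma laplacian_component: "laplacian (\<lambda>x. v x $ i) x = - (of_nat CARD('n) * wave_number\<^sup>2) * v x $ i"
proof -
  have "partial j (partial j (\<lambda>x. v x $ i)) x = - wave_number\<^sup>2 * v x $ i" for j
    unfolding unit_trig_poly_partial[OF L_pos unit_waves_partial] unfolding partial_component
    using unit_trig_poly_half_period[OF L_pos unit_waves, of x j]
    by (simp add: wave_number_def power2_eq_square)
  then show ?thesis by (simp add: laplacian_def)
qed

abbreviation g where "g \<equiv> advection v v"

lemma advection_component: "g x $ i = (\<Sum>j\<in>UNIV. v x $ j * partial j (\<lambda>y. v y $ i) x)"
  by (simp add: advection_def)

lemma C1_advection: "C1 (\<lambda>x. g x $ i)"
  unfolding advection_component by (intro C1_sum C1_mult C1_component C1_partial_component) auto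

lemma periodic_advection: "periodic L g"
  using periodic_flow periodic_partial[OF periodic_component]
  by (simp add: periodic_def vec_eq_iff advection_component)

text \<open>This is \<open>\<partial>\<^sub>j(\<nabla> \<cdot> v) = 0\<close>: both derivatives are translations, so they commute.\<close>
lemma solenoidal_partial: "(\<Sum>i\<in>UNIV. partial i (partial j (\<lambda>x. v x $ i)) x) = 0"
proof -
  have "partial i (partial j (\<lambda>x. v x $ i)) x = wave_number * partial i (\<lambda>x. v x $ i) (x + (L/4) *\<^sub>R axis j 1)" for i
    unfolding unit_trig_poly_partial[OF L_pos unit_waves_partial] unfolding partial_component
    by (simp add: wave_number_def add_ac)
  then show ?thesis
    using solenoidal[of "x + (L/4) *\<^sub>R axis j 1"] by (simp add: divergence_def sum_distrib_left[symmetric])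
qed

lemma divergence_advection:
  "divergence g x = (\<Sum>i\<in>UNIV. \<Sum>j\<in>UNIV. partial j (\<lambda>y. v y $ i) x * partial i (\<lambda>y. v y $ j) x)"
proof -
  have "partial i (\<lambda>y. g y $ i) x = (\<Sum>j\<in>UNIV. partial i (\<lambda>y. v y $ j) x * partial j (\<lambda>y. v y $ i) x)
      + (\<Sum>j\<in>UNIV. v x $ j * partial i (partial j (\<lambda>y. v y $ i)) x)" for i
    unfolding advection_component
    by (subst partial_sum) (auto simp: partial_mult differentiable_component differentiable_on_mult sum.distrib)
  moreover have "(\<Sum>i\<in>UNIV. \<Sum>j\<in>UNIV. v x $ j * partial i (partial j (\<lambda>y. v y $ i)) x) = 0"
    by (subst sum.swap) (simp add: sum_distrib_left[symmetric] solenoidal_partial)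
  ultimately show ?thesis
    by (simp add: divergence_def sum.distrib mult.commute)
qed

lemma advection_eq_tensor_divergence: "g = tensor_divergence (outer_product v v)"
proof (intro ext vec_eq_iff[THEN iffD2] allI)
  fix x i
  have "tensor_divergence (outer_product v v) x $ i =
      (\<Sum>j\<in>UNIV. partial j (\<lambda>y. v y $ i) x * v x $ j + v x $ i * partial j (\<lambda>y. v y $ j) x)"
    by (simp add: tensor_divergence_def outer_product_def partial_mult differentiable_component)
  also have "\<dots> = g x $ i"
    using solenoidal[of x]
    by (simp add: advection_component sum.distrib sum_distrib_left[symmetric] divergence_def mult.commute)
  finally show "g x $ i = tensor_divergence (outer_product v v) x $ i" ..
qed

text \<open>Each component is a sum of derivatives of the periodic functions \<open>v\<^sub>i v\<^sub>j\<close>.\<close>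
lemma advection_mean_zero: "(g has_integral 0) (periodic_cell L a)"
proof -
  have "((\<lambda>x. g x $ i) has_integral 0) (periodic_cell L a)" for i
  proof -
    have "((\<lambda>x. \<Sum>j\<in>UNIV. partial j (\<lambda>y. v y $ i * v y $ j) x) has_integral (\<Sum>j\<in>(UNIV::'n set). 0)) (periodic_cell L a)"
      by (intro has_integral_sum integral_partial_periodic C1_mult periodic_mult C1_component periodic_component L_pos) auto
    then show ?thesis
      by (simp add: advection_eq_tensor_divergence tensor_divergence_def outer_product_def)
  qed
  then show ?thesis
    by (subst has_integral_componentwise_iff) (auto simp: Basis_vec_def inner_axis)
qed

lemma navier_stokes_decay:
  fixes \<rho> \<kappa> :: real and p :: "real \<Rightarrow> real"
  defines "\<mu> \<equiv> of_nat CARD('n) * wave_number\<^sup>2 * \<kappa>"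
  shows "navier_stokes_solution \<rho> \<kappa> (\<lambda>t x. exp (- 2 * \<mu> * t) *\<^sub>R g x)
    (\<lambda>t x. exp (- \<mu> * t) *\<^sub>R v x) (\<lambda>t x. p t)"
  unfolding navier_stokes_solution_def
proof (intro conjI allI impI)
  fix t x i
  show "C2 (\<lambda>x. (exp (- \<mu> * t) *\<^sub>R v x) $ i)"
    by (simp add: C2_cmult C2_component)
  show "C1 (\<lambda>x::real^'n. p t)" by simp
  let ?S = "{0..} :: real set"
  have part: "partial j (\<lambda>y. exp (- \<mu> * t) * v y $ i) = (\<lambda>y. exp (- \<mu> * t) * partial j (\<lambda>y. v y $ i) y)" for j i
    by (rule partial_cmult) (rule differentiable_component)
  show "divergence (\<lambda>x. exp (- \<mu> * t) *\<^sub>R v x) x = 0"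
    using solenoidal[of x] by (simp only: divergence_def vector_scaleR_component part real_scaleR_def) (simp add: sum_distrib_left[symmetric])
  assume t: "0 \<le> t"
  have deriv: "((\<lambda>s. (exp (- \<mu> * s) *\<^sub>R v x) $ i) has_vector_derivative - \<mu> * exp (- \<mu> * t) * v x $ i) (at t within ?S)"
    unfolding has_real_derivative_iff_has_vector_derivative[symmetric]
    by (auto intro!: derivative_eq_intros)
  then show "(\<lambda>s. (exp (- \<mu> * s) *\<^sub>R v x) $ i) differentiable at t within ?S"
    by (rule differentiableI_vector)
  have "vector_derivative (\<lambda>s. (exp (- \<mu> * s) *\<^sub>R v x) $ i) (at t within ?S) = - \<mu> * exp (- \<mu> * t) * v x $ i"
    using t by (intro vector_derivative_within deriv) (auto simp: trivial_limit_within islimpt_Icc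
        intro: islimpt_subset[of t "{t..t + 1}"])
  moreover have "laplacian (\<lambda>y. (exp (- \<mu> * t) *\<^sub>R v y) $ i) x
      = exp (- \<mu> * t) * laplacian (\<lambda>y. v y $ i) x"
    by (simp add: laplacian_def part[simplified] partial_cmult differentiable_component sum_distrib_left)
  moreover have "(\<Sum>j\<in>UNIV. (exp (- \<mu> * t) *\<^sub>R v x) $ j * partial j (\<lambda>y. (exp (- \<mu> * t) *\<^sub>R v y) $ i) x)
      = (exp (- 2 * \<mu> * t) *\<^sub>R g x) $ i"
  proof -
    have "exp (- 2 * \<mu> * t) = exp (- \<mu> * t) * exp (- \<mu> * t)"
      by (simp flip: exp_add)
    then show ?thesis
      unfolding vector_scaleR_component real_scaleR_def part
      by (simp add: advection_component sum_distrib_left mult_ac)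
  qed
  ultimately show "vector_derivative (\<lambda>s. (exp (- \<mu> * s) *\<^sub>R v x) $ i) (at t within ?S)
      + (\<Sum>j\<in>UNIV. (exp (- \<mu> * t) *\<^sub>R v x) $ j * partial j (\<lambda>y. (exp (- \<mu> * t) *\<^sub>R v y) $ i) x)
      = \<kappa> * laplacian (\<lambda>y. (exp (- \<mu> * t) *\<^sub>R v y) $ i) x - inverse \<rho> * partial i (\<lambda>x. p t) x
        + (exp (- 2 * \<mu> * t) *\<^sub>R g x) $ i"
    by (simp add: laplacian_component \<mu>_def)
qed

text \<open>A sum or difference of two numbers \<open>\<plusminus>1\<close> is \<open>-2\<close>, \<open>0\<close> or \<open>2\<close>.\<close>
lemma advection_modes: "trig_poly L {k. \<forall>j. k $ j \<in> {-2, 0, 2}} (\<lambda>x. g x $ i)"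
  unfolding advection_component
proof (intro trig_poly_sum trig_poly_mult[OF unit_waves unit_waves_partial])
  fix k m :: "int^'n"
  assume "k \<in> unit_modes UNIV" "m \<in> unit_modes UNIV"
  then have units: "(k $ j = - 1 \<or> k $ j = 1) \<and> (m $ j = - 1 \<or> m $ j = 1)" for j
    by (simp add: unit_modes_def)
  have "(k + m) $ j \<in> {-2, 0, 2} \<and> (k - m) $ j \<in> {-2, 0, 2}" for j
    using units[of j] by (elim conjE disjE) simp_all
  then show "k + m \<in> {k. \<forall>j. k $ j \<in> {-2, 0, 2}} \<and> k - m \<in> {k. \<forall>j. k $ j \<in> {-2, 0, 2}}"
    by blast
qed auto

lemma independent_part_advection:
  "independent_part L i (\<lambda>y. g y $ i) x = of_real ((g x $ i + g (x + (L/4) *\<^sub>R axis i 1) $ i) / 2)"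
  by (rule independent_part_trig_poly[OF L_pos advection_modes]) simp

lemma advection_gradient_zero:
  assumes div: "divergence_free g" and grad: "is_gradient g"
  shows "g = (\<lambda>x. 0)"
proof -
  obtain c where c: "g = (\<lambda>x. c)"
    using periodic_divergence_free_gradient_constant[OF div periodic_advection L_pos grad] by blast
  have "((\<lambda>x. c) has_integral 0) (periodic_cell L (0::real^'n))"
    using advection_mean_zero[of 0] unfolding c .
  moreover have "((\<lambda>x. c) has_integral measure lborel (periodic_cell L (0::real^'n)) *\<^sub>R c) (periodic_cell L (0::real^'n))"
    by (rule has_integral_const)
  ultimately have "measure lborel (periodic_cell L (0::real^'n)) *\<^sub>R c = 0"
    by (rule has_integral_unique[symmetric])
  moreover have "measure lborel (periodic_cell L (0::real^'n)) = L ^ CARD('n)"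
    using L_pos by (subst content_cbox_cart) (auto simp: interval_ne_empty_cart less_imp_le)
  ultimately show ?thesis using L_pos by (simp add: c)
qed

end

section \<open>The canonical cyclic wave\<close>

lemma UNIV_7: "(UNIV :: 7 set) = {0, 1, 2, 3, 4, 5, 6}"
proof -
  have "card {0::7, 1, 2, 3, 4, 5, 6} = 7" by simp
  then show ?thesis by (intro card_subset_eq[symmetric]) auto
qed

lemma sum_7: "(\<Sum>i\<in>(UNIV::7 set). f i) = f 0 + f 1 + f 2 + f 3 + f 4 + f 5 + f 6"
  unfolding UNIV_7 by simp (simp only: add.assoc)

lemma numeral_7: "(7::7) = 0" "(8::7) = 1" "(9::7) = 2" "(10::7) = 3" "(11::7) = 4" "(12::7) = 5"
  by simp_all

lemma sum_shift_7: "(\<Sum>i\<in>UNIV. f (i + k)) = (\<Sum>i\<in>UNIV. f (i::7))"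
  by (rule sum.reindex_bij_witness[where i = "\<lambda>i. i - k" and j = "\<lambda>i. i + k"]) auto

lemma sum_offset_7: "(\<Sum>k\<in>UNIV. f (i + k)) = (\<Sum>j\<in>UNIV. f (j::7))"
  by (rule sum.reindex_bij_witness[where i = "\<lambda>j. j - i" and j = "\<lambda>k. i + k"]) auto

text \<open>Replacing one phase \<open>y\<^sub>j\<close> by \<open>y\<^sub>j + \<pi>/2\<close> differentiates with respect to \<open>y\<^sub>j\<close> any function
that is a linear combination of \<open>sin y\<^sub>j\<close> and \<open>cos y\<^sub>j\<close>.\<close>
definition quarter_turn :: "7 \<Rightarrow> (7 \<Rightarrow> real) \<Rightarrow> 7 \<Rightarrow> real" where
  "quarter_turn j y = y(j := y j + pi/2)"

definition wave_A :: "(7 \<Rightarrow> real) \<Rightarrow> 7 \<Rightarrow> real" where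
  "wave_A y i = sin (y i) * sin (y (i + 1)) * sin (y (i + 2)) * cos (y (i + 3)) *
     sin (y (i + 4)) * cos (y (i + 5)) * sin (y (i + 6))"

definition wave_B :: "(7 \<Rightarrow> real) \<Rightarrow> 7 \<Rightarrow> real" where
  "wave_B y i = cos (y i) * sin (y (i + 1)) * cos (y (i + 2)) * sin (y (i + 3)) *
     cos (y (i + 4)) * sin (y (i + 5)) * cos (y (i + 6))"

lemma quarter_turn_sin_cos:
  "sin (quarter_turn j y m) = (if m = j then cos (y m) else sin (y m))"
  "cos (quarter_turn j y m) = (if m = j then - sin (y m) else cos (y m))"
  by (simp_all add: quarter_turn_def sin_add cos_add)

text \<open>Cyclic symmetry reduces identities at the indices \<open>i\<close>, \<open>i + 1\<close>, \<dots> to the case \<open>i = 0\<close>,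
where all indices are numerals.\<close>
lemma wave_shift:
  "wave_A (quarter_turn (i + j) y) (i + k) = wave_A (quarter_turn j (\<lambda>m. y (i + m))) k"
  "wave_B (quarter_turn (i + j) y) (i + k) = wave_B (quarter_turn j (\<lambda>m. y (i + m))) k"
  by (simp_all add: wave_A_def wave_B_def quarter_turn_sin_cos add.assoc)

text \<open>The derivatives \<open>\<partial>\<^sub>iA\<^sub>i\<close> and \<open>- \<partial>\<^sub>i\<^sub>+\<^sub>1B\<^sub>i\<^sub>+\<^sub>1\<close> are the same monomial, so the divergence telescopes
around the index circle.\<close>
lemma wave_telescope: "wave_A (quarter_turn i y) i + wave_B (quarter_turn (i + 1) y) (i + 1) = 0"
proof -
  have "wave_A (quarter_turn 0 z) 0 + wave_B (quarter_turn 1 z) 1 = 0" for z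
    by (simp add: wave_A_def wave_B_def quarter_turn_sin_cos numeral_7)
  from this[of "\<lambda>m. y (i + m)"] show ?thesis
    by (simp only: wave_shift[symmetric] add_0_right)
qed

text \<open>Write \<open>a\<^sub>i\<^sub>j = \<partial>\<^sub>jA\<^sub>i\<close> and \<open>b\<^sub>i\<^sub>j = \<partial>\<^sub>jB\<^sub>i\<close>. These are signed products of one sine or cosine of each phase,
and two products of two of them can agree up to sign by an exchange of factors. The
seven identities list such coincidences with opposite signs. By
cyclic shifts, by symmetry in \<open>i\<close> and \<open>j\<close>, and by \<open>b\<^sub>i\<^sub>+\<^sub>1\<^sub>,\<^sub>i\<^sub>+\<^sub>1 = - a\<^sub>i\<^sub>i\<close> they reach all products
\<open>a\<^sub>i\<^sub>j a\<^sub>j\<^sub>i\<close>, \<open>b\<^sub>i\<^sub>j b\<^sub>j\<^sub>i\<close> and \<open>a\<^sub>i\<^sub>j b\<^sub>j\<^sub>i\<close>.\<close>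
lemma wave_pairings:
  fixes y :: "7 \<Rightarrow> real"
  shows
    "wave_A (quarter_turn 0 y) 0 * wave_A (quarter_turn 0 y) 0 +
     wave_A (quarter_turn 3 y) 2 * wave_B (quarter_turn 2 y) 3 = 0"
    "wave_A (quarter_turn 1 y) 0 * wave_A (quarter_turn 0 y) 1 +
     wave_A (quarter_turn 1 y) 1 * wave_B (quarter_turn 1 y) 1 = 0"
    "wave_A (quarter_turn 2 y) 0 * wave_A (quarter_turn 0 y) 2 +
     wave_A (quarter_turn 3 y) 0 * wave_B (quarter_turn 0 y) 3 = 0"
    "wave_A (quarter_turn 4 y) 0 * wave_A (quarter_turn 0 y) 4 +
     wave_A (quarter_turn 5 y) 0 * wave_B (quarter_turn 0 y) 5 = 0"
    "wave_B (quarter_turn 1 y) 0 * wave_A (quarter_turn 0 y) 1 +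
     wave_B (quarter_turn 2 y) 0 * wave_B (quarter_turn 0 y) 2 = 0"
    "wave_B (quarter_turn 3 y) 0 * wave_A (quarter_turn 0 y) 3 +
     wave_B (quarter_turn 4 y) 0 * wave_B (quarter_turn 0 y) 4 = 0"
    "wave_A (quarter_turn 2 y) 0 * wave_B (quarter_turn 0 y) 2 +
     wave_B (quarter_turn 2 y) 1 * wave_B (quarter_turn 1 y) 2 = 0"
  unfolding wave_A_def wave_B_def quarter_turn_sin_cos
  by (simp_all add: numeral_7 del: mult_eq_0_iff split del: if_split)

lemma wave_divergence:
  "(\<Sum>i\<in>UNIV. wave_A (quarter_turn i y) i + wave_B (quarter_turn i y) i) = 0"
proof -
  have "(\<Sum>i\<in>UNIV. wave_A (quarter_turn i y) i + wave_B (quarter_turn (i + 1) y) (i + 1)) = 0"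
    by (simp only: wave_telescope) simp
  then show ?thesis
    using sum_shift_7[of "\<lambda>i. wave_B (quarter_turn i y) i" 1] by (simp add: sum.distrib)
qed

text \<open>With \<open>aa k = \<Sum>\<^sub>i a\<^sub>i\<^sub>,\<^sub>i\<^sub>+\<^sub>k a\<^sub>i\<^sub>+\<^sub>k\<^sub>,\<^sub>i\<close> and \<open>bb k\<close>, \<open>ab k\<close> alike, the double sum is
\<open>\<Sum>\<^sub>k (aa k + bb k + 2 ab k)\<close>. Here \<open>aa\<close> and \<open>bb\<close> are even in \<open>k\<close>, and summing the pairings over
\<open>i\<close> expresses each \<open>ab k\<close> as minus one of the \<open>aa\<close> or \<open>bb\<close>, so that everything cancels.
The square of the diagonal occurs as \<open>aa 0 = bb 0\<close> and is compensated by \<open>2 ab 1\<close>.\<close>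
lemma wave_gradient_square:
  fixes y :: "7 \<Rightarrow> real"
  defines "J \<equiv> \<lambda>i j. wave_A (quarter_turn j y) i + wave_B (quarter_turn j y) i"
  shows "(\<Sum>i\<in>UNIV. \<Sum>j\<in>UNIV. J i j * J j i) = 0"
proof -
  define a where "a i j = wave_A (quarter_turn j y) i" for i j
  define b where "b i j = wave_B (quarter_turn j y) i" for i j
  define aa where "aa k = (\<Sum>i\<in>UNIV. a i (i + k) * a (i + k) i)" for k
  define bb where "bb k = (\<Sum>i\<in>UNIV. b i (i + k) * b (i + k) i)" for k
  define ab where "ab k = (\<Sum>i\<in>UNIV. a i (i + k) * b (i + k) i)" for k
  have shift: "wave_A (quarter_turn l (\<lambda>m. y (i + m))) k = a (i + k) (i + l)"
    "wave_B (quarter_turn l (\<lambda>m. y (i + m))) k = b (i + k) (i + l)" for i k l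
    by (simp_all only: a_def b_def wave_shift)
  have pairings:
    "a i i * a i i + a (i + 2) (i + 3) * b (i + 3) (i + 2) = 0"
    "a i (i + 1) * a (i + 1) i + a (i + 1) (i + 1) * b (i + 1) (i + 1) = 0"
    "a i (i + 2) * a (i + 2) i + a i (i + 3) * b (i + 3) i = 0"
    "a i (i + 4) * a (i + 4) i + a i (i + 5) * b (i + 5) i = 0"
    "b i (i + 1) * a (i + 1) i + b i (i + 2) * b (i + 2) i = 0"
    "b i (i + 3) * a (i + 3) i + b i (i + 4) * b (i + 4) i = 0"
    "a i (i + 2) * b (i + 2) i + b (i + 1) (i + 2) * b (i + 2) (i + 1) = 0"
    for i
    by (fact wave_pairings[of "\<lambda>m. y (i + m)", unfolded shift add_0_right])+
  have flip: "(\<Sum>i\<in>UNIV. f (i + k) i) = (\<Sum>i\<in>UNIV. f i (i + l))" if "k + l = 0"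
    for f :: "7 \<Rightarrow> 7 \<Rightarrow> real" and k l :: 7
    using sum_shift_7[of "\<lambda>i. f i (i + l)" k] that by (simp add: add.assoc)
  have aa_flip: "aa 6 = aa 1" "aa 5 = aa 2" "aa 4 = aa 3" and bb_flip: "bb 6 = bb 1" "bb 5 = bb 2" "bb 4 = bb 3"
    unfolding aa_def bb_def
    using flip[of 1 6 "\<lambda>i j. a i j * a j i"] flip[of 2 5 "\<lambda>i j. a i j * a j i"] flip[of 3 4 "\<lambda>i j. a i j * a j i"]
      flip[of 1 6 "\<lambda>i j. b i j * b j i"] flip[of 2 5 "\<lambda>i j. b i j * b j i"] flip[of 3 4 "\<lambda>i j. b i j * b j i"]
    by (simp_all add: mult.commute)
  have ba: "(\<Sum>i\<in>UNIV. b i (i + k) * a (i + k) i) = ab l" if "k + l = 0" for k l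
    unfolding ab_def using flip[OF that, of "\<lambda>i j. a i j * b j i"] by (simp add: mult.commute)
  have bb0: "bb 0 = aa 0"
  proof -
    have "b (i + 1) (i + 1) = - a i i" for i
      using wave_telescope[where y = y and i = i] by (simp add: a_def b_def)
    then show ?thesis
      unfolding aa_def bb_def using sum_shift_7[of "\<lambda>i. b i i * b i i" 1] by simp
  qed
  have pairings_sum:
    "aa 0 + ab 1 = 0" "aa 1 + ab 0 = 0" "aa 2 + ab 3 = 0" "aa 4 + ab 5 = 0"
    "ab 6 + bb 2 = 0" "ab 4 + bb 4 = 0" "ab 2 + bb 1 = 0"
  proof -
    have ab_shift: "ab k = (\<Sum>i\<in>UNIV. a (i + l) (i + l + k) * b (i + l + k) (i + l))" for k l
      unfolding ab_def by (rule sum_shift_7[symmetric])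
    have bb_shift: "bb k = (\<Sum>i\<in>UNIV. b (i + l) (i + l + k) * b (i + l + k) (i + l))" for k l
      unfolding bb_def by (rule sum_shift_7[symmetric])
    show "aa 0 + ab 1 = 0"
      using pairings(1) ab_shift[of 1 2] by (simp add: aa_def sum.distrib[symmetric] add.assoc)
    show "aa 1 + ab 0 = 0"
      using pairings(2) ab_shift[of 0 1] by (simp add: aa_def sum.distrib[symmetric])
    show "aa 2 + ab 3 = 0" "aa 4 + ab 5 = 0"
      using pairings(3,4) by (simp_all add: aa_def ab_def sum.distrib[symmetric])
    show "ab 6 + bb 2 = 0" "ab 4 + bb 4 = 0"
      using pairings(5,6) ba[of 1 6, symmetric] ba[of 3 4, symmetric] by (simp_all add: bb_def sum.distrib[symmetric])
    show "ab 2 + bb 1 = 0"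
      using pairings(7) bb_shift[of 1 1] by (simp add: ab_def sum.distrib[symmetric] add.assoc)
  qed
  have "(\<Sum>i\<in>UNIV. \<Sum>j\<in>UNIV. J i j * J j i) = (\<Sum>k\<in>UNIV. aa k + bb k + ab k + ab (- k))"
  proof -
    have "(\<Sum>i\<in>UNIV. \<Sum>j\<in>UNIV. J i j * J j i) = (\<Sum>i\<in>UNIV. \<Sum>k\<in>UNIV. J i (i + k) * J (i + k) i)"
      by (rule sum.cong[OF refl], rule sum_offset_7[symmetric])
    also have "\<dots> = (\<Sum>k\<in>UNIV. \<Sum>i\<in>UNIV. J i (i + k) * J (i + k) i)"
      by (rule sum.swap)
    also have "\<dots> = (\<Sum>k\<in>UNIV. aa k + bb k + ab k + ab (- k))"
    proof (rule sum.cong[OF refl])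
      fix k
      have "J i (i + k) * J (i + k) i = a i (i + k) * a (i + k) i + b i (i + k) * b (i + k) i
          + a i (i + k) * b (i + k) i + b i (i + k) * a (i + k) i" for i
        by (simp add: J_def a_def b_def algebra_simps)
      then show "(\<Sum>i\<in>UNIV. J i (i + k) * J (i + k) i) = aa k + bb k + ab k + ab (- k)"
        using ba[of k "- k"] by (simp add: sum.distrib aa_def bb_def ab_def)
    qed
    finally show ?thesis .
  qed
  moreover have "(\<Sum>k\<in>UNIV. ab (- k)) = (\<Sum>k\<in>UNIV. ab k)"
    by (rule sum.reindex_bij_witness[where i = uminus and j = uminus]) auto
  ultimately show ?thesis
    using pairings_sum aa_flip bb_flip bb0 by (simp add: sum.distrib sum_7)
qed

section \<open>Both phase vectors give the canonical wave\<close>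

text \<open>Each of the two terms contains every coordinate exactly once; the constants \<open>1\<close> and \<open>-1\<close> inserted in
front of them start the multiplication.\<close>
lemma base_velocity_unit_waves:
  assumes "\<alpha> > 0"
  shows "trig_poly (2 * pi / \<alpha>) (unit_modes UNIV) (\<lambda>x. base_velocity \<alpha> v\<^sub>r \<xi> x $ i)"
proof -
  have all: "insert (i + 6) (insert (i + 5) (insert (i + 4) (insert (i + 3) (insert (i + 2) (insert (i + 1) {i}))))) = UNIV"
  proof -
    have "card {i + 6, i + 5, i + 4, i + 3, i + 2, i + 1, i} = 7" by simp
    then show ?thesis by (intro card_subset_eq) auto
  qed
  have *: "i + 1 - 1 = i" "i + 2 - 1 = i + 1" "i + 3 - 1 = i + 2" "i + 4 - 1 = i + 3" "i + 5 - 1 = i + 4"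
    "i + 6 - 1 = i + 5" "i + 7 - 1 = i + 6"
    by simp_all
  have expand: "base_velocity \<alpha> v\<^sub>r \<xi> x $ i = v\<^sub>r *
    (1 * sin (\<alpha> * x $ i + \<xi> $ 1) * cos (\<alpha> * x $ (i+1) + \<xi> $ 2) * sin (\<alpha> * x $ (i+2) + \<xi> $ 3) *
     cos (\<alpha> * x $ (i+3) + \<xi> $ 4) * sin (\<alpha> * x $ (i+4) + \<xi> $ 5) * cos (\<alpha> * x $ (i+5) + \<xi> $ 6) *
     sin (\<alpha> * x $ (i+6) + \<xi> $ 7)
   + (- 1) * sin (\<alpha> * x $ i + \<xi> $ 2) * sin (\<alpha> * x $ (i+1) + \<xi> $ 3) * cos (\<alpha> * x $ (i+2) + \<xi> $ 4) *
     sin (\<alpha> * x $ (i+3) + \<xi> $ 5) * cos (\<alpha> * x $ (i+4) + \<xi> $ 6) * sin (\<alpha> * x $ (i+5) + \<xi> $ 7) *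
     cos (\<alpha> * x $ (i+6) + \<xi> $ 1))" for x
    unfolding base_velocity_def first_component_def vec_lambda_beta * by simp
  show ?thesis
    unfolding expand all[symmetric]
    by (intro trig_poly.scale trig_poly.add trig_poly_mult_sin trig_poly_mult_cos trig_poly_const assms) auto
qed

text \<open>For the phases \<open>\<xi>\<^sup>*\<^sup>*\<close> all shifts are multiples of \<open>\<pi>/2\<close>, and rewriting them produces the canonical
wave itself. For \<open>\<xi>\<^sup>*\<close> the common shift \<open>\<pi>/4\<close> is absorbed in \<open>\<theta>\<close>; what is left is the canonical
wave read backwards along the index circle, \<open>\<tau> = -1\<close>, with the two terms \<open>A\<close> and \<open>B\<close> exchanging roles and
with opposite sign.\<close>
lemma base_velocity_waves:
  assumes \<xi>: "\<xi> = vector [- (pi/4), pi/4, pi/4, pi/4, pi/4, pi/4, pi/4] \<or>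
      \<xi> = vector [0, pi/2, pi, pi, pi, pi, pi]"
    and v: "v\<^sub>r > 0"
  obtains c \<theta> :: real and \<tau> :: 7 where "c \<noteq> 0" "\<tau> * \<tau> = 1"
    "\<And>x i. base_velocity \<alpha> v\<^sub>r \<xi> x $ (\<tau> * i) =
       c * (wave_A (\<lambda>m. \<alpha> * x $ (\<tau> * m) + \<theta>) i + wave_B (\<lambda>m. \<alpha> * x $ (\<tau> * m) + \<theta>) i)"
proof -
  have offset: "i + 1 - 1 = i" "i + 2 - 1 = i + 1" "i + 3 - 1 = i + 2" "i + 4 - 1 = i + 3" "i + 5 - 1 = i + 4"
    "i + 6 - 1 = i + 5" "i + 7 - 1 = i + 6" for i :: 7
    by simp_all
  have entries: "vector [a1, a2, a3, a4, a5, a6, a7] $ (1::7) = a1" "vector [a1, a2, a3, a4, a5, a6, a7] $ (2::7) = a2"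
    "vector [a1, a2, a3, a4, a5, a6, a7] $ (3::7) = a3" "vector [a1, a2, a3, a4, a5, a6, a7] $ (4::7) = a4"
    "vector [a1, a2, a3, a4, a5, a6, a7] $ (5::7) = a5" "vector [a1, a2, a3, a4, a5, a6, a7] $ (6::7) = a6"
    "vector [a1, a2, a3, a4, a5, a6, a7] $ (7::7) = a7" for a1 a2 a3 a4 a5 a6 a7 :: real
    unfolding vector_def vec_lambda_beta foldr.simps o_apply id_apply fun_upd_apply
    by simp_all
  from \<xi> show thesis
  proof
    assume \<xi>: "\<xi> = vector [- (pi/4), pi/4, pi/4, pi/4, pi/4, pi/4, pi/4]"
    have minus: "- (i + 1) = - i + 6" "- (i + 2) = - i + 5" "- (i + 3) = - i + 4"
      "- (i + 4) = - i + 3" "- (i + 5) = - i + 2" "- (i + 6) = - i + 1" for i :: 7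
      by simp_all
    \<comment> \<open>The first phase differs from the others by \<open>\<pi>/2\<close>; this expresses it through the common shift \<open>\<pi>/4\<close>.\<close>
    have first: "sin (z + - (pi/4)) = - cos (z + pi/4)" "cos (z + - (pi/4)) = sin (z + pi/4)" for z :: real
      by (simp_all add: sin_add cos_add sin_diff cos_diff sin_45 cos_45)
    show thesis
    proof (rule that[of "- v\<^sub>r" "- 1" "pi/4"])
      fix x i
      show "base_velocity \<alpha> v\<^sub>r \<xi> x $ (- 1 * i) =
        - v\<^sub>r * (wave_A (\<lambda>m. \<alpha> * x $ (- 1 * m) + pi/4) i + wave_B (\<lambda>m. \<alpha> * x $ (- 1 * m) + pi/4) i)"
        unfolding base_velocity_def first_component_def wave_A_def wave_B_def vec_lambda_beta \<xi> entries mult_minus1 minus offset first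
        by algebra
    qed (use v in auto)
  next
    assume \<xi>: "\<xi> = vector [0, pi/2, pi, pi, pi, pi, pi]"
    have trig: "sin (z + pi) = - sin z" "cos (z + pi) = - cos z"
      "sin (z + pi/2) = cos z" "cos (z + pi/2) = - sin z" for z :: real
      by (simp_all add: sin_add cos_add)
    show thesis
    proof (rule that[of v\<^sub>r 1 0])
      fix x i
      show "base_velocity \<alpha> v\<^sub>r \<xi> x $ (1 * i) =
        v\<^sub>r * (wave_A (\<lambda>m. \<alpha> * x $ (1 * m) + 0) i + wave_B (\<lambda>m. \<alpha> * x $ (1 * m) + 0) i)"
        unfolding base_velocity_def first_component_def wave_A_def wave_B_def vec_lambda_beta \<xi> entries mult_1 offset trig add_0_right
        by algebra
    qed (use v in auto)
  qed
qed

section \<open>The forced flow\<close>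

text \<open>A velocity field on \<open>\<real>\<^sup>7\<close> that is the canonical wave up to amplitude, translation and the reflection
of the index circle (\<open>\<tau> = \<plusminus>1\<close>, the solutions of \<open>\<tau>\<^sup>2 = 1\<close> modulo \<open>7\<close>).\<close>
locale cyclic_wave_flow =
  fixes \<alpha> c \<theta> :: real and \<tau> :: 7 and v :: "real^7 \<Rightarrow> real^7"
  assumes \<alpha>_pos: "\<alpha> > 0" and amplitude: "c \<noteq> 0" and involution: "\<tau> * \<tau> = 1"
    and unit_waves: "trig_poly (2 * pi / \<alpha>) (unit_modes UNIV) (\<lambda>x. v x $ i)"
    and waves: "v x $ (\<tau> * i) =
      c * (wave_A (\<lambda>m. \<alpha> * x $ (\<tau> * m) + \<theta>) i + wave_B (\<lambda>m. \<alpha> * x $ (\<tau> * m) + \<theta>) i)"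
begin

definition phases :: "real^7 \<Rightarrow> 7 \<Rightarrow> real" where
  "phases x m = \<alpha> * x $ (\<tau> * m) + \<theta>"

definition profile :: "(7 \<Rightarrow> real) \<Rightarrow> 7 \<Rightarrow> real" where
  "profile y i = wave_A y i + wave_B y i"

lemma component: "v x $ (\<tau> * i) = c * profile (phases x) i"
  unfolding profile_def using waves[of x i] by (simp only: phases_def[abs_def])

lemma \<tau>_cancel: "\<tau> * (\<tau> * i) = i"
  using involution by (simp add: mult.assoc[symmetric])

lemma sum_\<tau>: "(\<Sum>i\<in>UNIV. f (\<tau> * i)) = (\<Sum>i\<in>UNIV. f i)"
  by (rule sum.reindex_bij_witness[where i = "\<lambda>i. \<tau> * i" and j = "\<lambda>i. \<tau> * i"]) (auto simp: \<tau>_cancel)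

lemma phases_shift:
  "phases (x + ((2 * pi / \<alpha>) / 4) *\<^sub>R axis (\<tau> * j) 1) = quarter_turn j (phases x)"
proof
  fix m
  have "\<tau> * m = \<tau> * j \<longleftrightarrow> m = j" by (metis \<tau>_cancel)
  then show "phases (x + ((2 * pi / \<alpha>) / 4) *\<^sub>R axis (\<tau> * j) 1) m = quarter_turn j (phases x) m"
    using \<alpha>_pos by (simp add: phases_def quarter_turn_def axis_def distrib_left)
qed

lemma partial_wave:
  "partial (\<tau> * j) (\<lambda>x. v x $ (\<tau> * i)) x = \<alpha> * c * profile (quarter_turn j (phases x)) i"
proof -
  have "2 * pi / \<alpha> > 0" using \<alpha>_pos by simp
  note partial = unit_trig_poly_partial[OF this unit_waves]
  show ?thesis
    unfolding partial unfolding component phases_shift using \<alpha>_pos by simp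
qed

sublocale unit_wave_flow "2 * pi / \<alpha>" v
proof
  show "divergence v x = 0" for x
  proof -
    have "divergence v x = (\<Sum>i\<in>UNIV. partial (\<tau> * i) (\<lambda>x. v x $ (\<tau> * i)) x)"
      unfolding divergence_def by (rule sum_\<tau>[symmetric])
    then show ?thesis
      using wave_divergence[of "phases x"] by (simp add: partial_wave profile_def sum_distrib_left[symmetric])
  qed
qed (use \<alpha>_pos unit_waves in auto)

lemma divergence_free_advection: "divergence_free g"
proof -
  have "divergence g x = 0" for x
  proof -
    have "divergence g x = (\<Sum>i\<in>UNIV. \<Sum>j\<in>UNIV.
        partial (\<tau> * j) (\<lambda>y. v y $ (\<tau> * i)) x * partial (\<tau> * i) (\<lambda>y. v y $ (\<tau> * j)) x)"
      unfolding divergence_advection by (subst sum_\<tau>[symmetric], subst sum_\<tau>[symmetric]) (rule refl)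
    also have "\<dots> = (\<alpha> * c)\<^sup>2 * (\<Sum>i\<in>UNIV. \<Sum>j\<in>UNIV.
        profile (quarter_turn j (phases x)) i * profile (quarter_turn i (phases x)) j)"
      unfolding partial_wave by (simp add: sum_distrib_left power2_eq_square mult_ac)
    also have "\<dots> = 0"
      using wave_gradient_square[of "phases x"] by (simp add: profile_def)
    finally show ?thesis .
  qed
  then show ?thesis
    by (simp add: divergence_free_def C1_advection)
qed

lemma advection_wave:
  "g x $ 0 = \<alpha> * c\<^sup>2 * (\<Sum>j\<in>UNIV. profile (phases x) j * profile (quarter_turn j (phases x)) 0)"
proof -
  have "g x $ (\<tau> * 0) = (\<Sum>j\<in>UNIV. v x $ (\<tau> * j) * partial (\<tau> * j) (\<lambda>y. v y $ (\<tau> * 0)) x)"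
    unfolding advection_component by (rule sum_\<tau>[symmetric])
  then show ?thesis
    unfolding partial_wave unfolding component by (simp add: sum_distrib_left power2_eq_square mult_ac)
qed

text \<open>The component with index \<open>0\<close>, averaged over two points a quarter period apart, is evaluated at one place. Where all
phases are multiples of \<open>\<pi>/2\<close> this average vanishes; one phase \<open>\<pi>/4\<close> suffices to make it
nonzero.\<close>
lemma not_reduction_condition: "\<not> reduction_condition (2 * pi / \<alpha>) g"
proof
  assume red: "reduction_condition (2 * pi / \<alpha>) g"
  define y :: "7 \<Rightarrow> real" where "y m = (if m = 1 \<or> m = 3 then pi/2 else if m = 6 then pi/4 else 0)" for m
  define x :: "real^7" where "x = (\<chi> m. (y (\<tau> * m) - \<theta>) / \<alpha>)"
  have y: "phases x = y"
    using \<alpha>_pos by (simp add: phases_def x_def \<tau>_cancel fun_eq_iff)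
  have y': "phases (x + ((2 * pi / \<alpha>) / 4) *\<^sub>R axis 0 1) = quarter_turn 0 y"
    using phases_shift[of x 0] y by simp
  have trig_y: "sin (y 0) = 0" "cos (y 0) = 1" "sin (y 1) = 1" "cos (y 1) = 0" "sin (y 2) = 0" "cos (y 2) = 1"
    "sin (y 3) = 1" "cos (y 3) = 0" "sin (y 4) = 0" "cos (y 4) = 1" "sin (y 5) = 0" "cos (y 5) = 1"
    "sin (y 6) = sqrt 2 / 2" "cos (y 6) = sqrt 2 / 2"
    by (simp_all add: y_def sin_45 cos_45)
  have "(\<Sum>j\<in>UNIV. profile y j * profile (quarter_turn j y) 0) +
      (\<Sum>j\<in>UNIV. profile (quarter_turn 0 y) j * profile (quarter_turn j (quarter_turn 0 y)) 0) = 1/2"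
    unfolding sum_7 profile_def wave_A_def wave_B_def quarter_turn_sin_cos
    by (simp add: numeral_7 trig_y)
  moreover have "of_real ((g x $ 0 + g (x + ((2 * pi / \<alpha>) / 4) *\<^sub>R axis 0 1) $ 0) / 2) = (0::complex)"
    using red unfolding reduction_condition_def by (simp only: independent_part_advection[symmetric])
  then have "g x $ 0 + g (x + ((2 * pi / \<alpha>) / 4) *\<^sub>R axis 0 1) $ 0 = 0"
    unfolding of_real_eq_0_iff by simp
  then have "\<alpha> * c\<^sup>2 * ((\<Sum>j\<in>UNIV. profile y j * profile (quarter_turn j y) 0) +
      (\<Sum>j\<in>UNIV. profile (quarter_turn 0 y) j * profile (quarter_turn j (quarter_turn 0 y)) 0)) = 0"
    unfolding advection_wave y y' by (simp only: distrib_left)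
  ultimately show False
    using \<alpha>_pos amplitude by simp
qed

end

theorem proposition7p2:
  fixes \<alpha> v\<^sub>r \<rho> \<kappa> L :: real
    and \<xi> :: "real^7"
    and v0 g0 f0 :: "real^7 \<Rightarrow> real^7"
  assumes "\<alpha> > 0" and "v\<^sub>r > 0" and "\<rho> > 0" and "\<kappa> > 0"
    and "\<xi> = vector [- (pi/4), pi/4, pi/4, pi/4, pi/4, pi/4, pi/4] \<or>
         \<xi> = vector [0, pi/2, pi, pi, pi, pi, pi]"
    and "L = 2 * pi / \<alpha>"
    and "v0 = base_velocity \<alpha> v\<^sub>r \<xi>"
    and "g0 = advection v0 v0"
    and "f0 = g0"
  shows "\<not> reduction_condition L g0 \<and>
    periodic L v0 \<and>
    v0 \<noteq> (\<lambda>x. 0) \<and>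
    divergence_free v0 \<and>
    divergence_free g0 \<and>
    purely_transverse L g0 \<and>
    \<not> is_gradient g0 \<and>
    (\<forall>p. C2 p \<and> periodic L p \<and> (\<forall>x. laplacian p x = - \<rho> * divergence g0 x)
       \<longrightarrow> (\<exists>c. \<forall>x. p x = c)) \<and>
    f0 = tensor_divergence (outer_product v0 v0) \<and>
    (\<forall>a. (f0 has_integral 0) (cbox a (a + (\<chi> j. L)))) \<and>
    (\<forall>p :: real \<Rightarrow> real.
       (\<forall>t\<ge>0. \<forall>x :: real^7. gradient (\<lambda>y. p t) x = 0) \<and>
       navier_stokes_solution \<rho> \<kappa>
         (\<lambda>t x. exp (- 14 * \<alpha>\<^sup>2 * \<kappa> * t) *\<^sub>R f0 x)
         (\<lambda>t x. exp (- 7 * \<alpha>\<^sup>2 * \<kappa> * t) *\<^sub>R v0 x)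
         (\<lambda>t x. p t))"
proof -
  obtain c \<theta> :: real and \<tau> :: 7 where "c \<noteq> 0" "\<tau> * \<tau> = 1"
    and waves: "\<And>x i. v0 x $ (\<tau> * i) =
       c * (wave_A (\<lambda>m. \<alpha> * x $ (\<tau> * m) + \<theta>) i + wave_B (\<lambda>m. \<alpha> * x $ (\<tau> * m) + \<theta>) i)"
    using base_velocity_waves[OF assms(5,2)] unfolding \<open>v0 = base_velocity \<alpha> v\<^sub>r \<xi>\<close> by metis
  then interpret cyclic_wave_flow \<alpha> c \<theta> \<tau> v0
    using base_velocity_unit_waves[OF \<open>\<alpha> > 0\<close>] \<open>\<alpha> > 0\<close> \<open>v0 = base_velocity \<alpha> v\<^sub>r \<xi>\<close>
    by unfold_locales auto
  note L = \<open>L = 2 * pi / \<alpha>\<close> and g0 = \<open>g0 = advection v0 v0\<close> and f0 = \<open>f0 = g0\<close>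
  have red: "\<not> reduction_condition L g0"
    using not_reduction_condition by (simp add: L g0)
  have nonzero: "g0 \<noteq> (\<lambda>x. 0)"
    using red reduction_condition_zero by metis
  have "v0 \<noteq> (\<lambda>x. 0)"
  proof
    assume "v0 = (\<lambda>x. 0)"
    then have "g0 = (\<lambda>x. 0)" by (simp add: g0 advection_def fun_eq_iff vec_eq_iff)
    with nonzero show False ..
  qed
  moreover have "divergence_free v0"
    by (simp add: divergence_free_def C1_component solenoidal)
  moreover have div: "divergence_free g0"
    unfolding g0 by (rule divergence_free_advection)
  moreover have "purely_transverse L g0"
    using purely_transverseI[OF _ div] L_pos by (simp add: L)
  moreover have "\<not> is_gradient g0"
    using advection_gradient_zero[OF divergence_free_advection] nonzero by (auto simp: g0)
  moreover have "\<exists>c. \<forall>x. p x = c"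
    if "C2 p" "periodic L p" "\<forall>x. laplacian p x = - \<rho> * divergence g0 x" for p
    using periodic_harmonic_constant[OF that(1,2)] that(3) div L_pos by (simp add: L divergence_free_def)
  moreover have "f0 = tensor_divergence (outer_product v0 v0)"
    unfolding f0 g0 by (rule advection_eq_tensor_divergence)
  moreover have "(f0 has_integral 0) (periodic_cell L a)" for a
    unfolding f0 g0 L by (rule advection_mean_zero)
  moreover have "navier_stokes_solution \<rho> \<kappa>
      (\<lambda>t x. exp (- 14 * \<alpha>\<^sup>2 * \<kappa> * t) *\<^sub>R f0 x) (\<lambda>t x. exp (- 7 * \<alpha>\<^sup>2 * \<kappa> * t) *\<^sub>R v0 x) (\<lambda>t x. p t)" for p
  proof -
    have "wave_number = \<alpha>" using \<open>\<alpha> > 0\<close> by (simp add: wave_number_def)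
    then show ?thesis
      using navier_stokes_decay[of \<rho> \<kappa> p] by (simp add: f0 g0 mult.assoc)
  qed
  moreover have "gradient (\<lambda>y. p t) x = 0" for p :: "real \<Rightarrow> real" and t and x :: "real^7"
    by (simp add: gradient_def vec_eq_iff)
  ultimately show ?thesis
    using red periodic_flow by (simp add: L)
qed

end
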